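(* Fix $k\in\mathbb{Z}_{\geq 1}$. The feasible region $P^{\mathrm{Av}(312)}_k$ equals the cycle polytope $P(\mathcal{O}v(k,\mathrm{Av}(312)))$ (viewed inside $\mathbb R^{\mathcal S_k}$). Its dimension is $C_k-C_{k-1}$, where $C_k=\frac{1}{k+1}\binom{2k}{k}$ is the $k$-th Catalan number, and its vertices are exactly the vectors $\vec e_{\mathcal C}$ for $\mathcal C$ ranging over the simple cycles of $\mathcal{O}v(k,\mathrm{Av}(312))$.
   Context: For $n\ge1$, $\mathcal S_n$ is the set of permutations of $[n]$ in one-line notation; by convention $\mathcal S_0$ and $\mathrm{Av}_0(B)$ consist of the empty permutation. For distinct reals $x_1,\dots,x_m$, $\mathrm{std}(x_1,\dots,x_m)$ is the unique $\pi\in\mathcal S_m$ with $\pi(i)<\pi(j)\iff x_i<x_j$; for $I=\{i_1<\dots<i_m\}$, $\mathrm{pat}_I(\sigma)=\mathrm{std}(\sigma(i_1),\dots,\sigma(i_m))$. $\sigma$ avoids $\pi$ if no $I$ has $\mathrm{pat}_I(\sigma)=\pi$; $\mathrm{Av}_n(B)$ is the set of size-$n$ permutations avoiding all elements of $B$, $\mathrm{Av}(B)=\bigcup_{n\ge1}\mathrm{Av}_n(B)$. For $\pi\in\mathcal S_k,\sigma\in\mathcal S_n$, $\mathrm{c\text{-}occ}(\pi,\sigma)$ is the number of intervals $I=\{i,\dots,i+k-1\}\subseteq[n]$ with $\mathrm{pat}_I(\sigma)=\pi$, and $\widetilde{\mathrm{c\text{-}occ}}(\pi,\sigma)=\mathrm{c\text{-}occ}(\pi,\sigma)/n$.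 Feasible region: $P^{\mathrm{Av}(B)}_k$ is the set of $\vec v\in[0,1]^{\mathcal S_k}$ for which there is a sequence $(\sigma^m)$ in $\mathrm{Av}(B)$ with $|\sigma^m|\to\infty$ and $\widetilde{\mathrm{c\text{-}occ}}(\pi,\sigma^m)\to\vec v_\pi$ for all $\pi\in\mathcal S_k$. Overlap graph: $\mathcal{O}v(k,\mathrm{Av}(B))$ is the directed multigraph with vertex set $\mathrm{Av}_{k-1}(B)$ and, for each $\pi\in\mathrm{Av}_k(B)$, one edge labelled $\pi$ from $\mathrm{pat}_{\{1,\dots,k-1\}}(\pi)$ to $\mathrm{pat}_{\{2,\dots,k\}}(\pi)$. A simple cycle is a closed walk with distinct edges and distinct vertices. For a nonempty cycle $\mathcal C$, $\vec e_{\mathcal C}\in\mathbb R^{E}$ has $e$-coordinate (number of occurrences of $e$ in $\mathcal C$)$/|\mathcal C|$; the cycle polytope is $P(G)=\mathrm{conv}\{\vec e_{\mathcal C}:\mathcal C\text{ simple cycle}\}$. Since edges of $\mathcal{O}v(k,\mathrm{Av}(B))$ are in bijection with $\mathrm{Av}_k(B)$, $\mathbb R^{E}=\mathbb R^{\mathrm{Av}_k(B)}$ is identified with the subspace of $\mathbb R^{\mathcal S_k}$ of vectors vanishing outside $\mathrm{Av}_k(B)$. Dimension means dimension of the affine hull. *)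

theory Defs
  imports "HOL-Analysis.Analysis" "HOL-Library.Function_Algebras"
begin

text \<open>Vectors of R^{S_k} are represented as functions nat list => real that vanish
  outside S_k.  We equip the function type with its pointwise real vector space
  structure so that the library notions (convex hull, extreme points, dim) apply.\<close>

instantiation "fun" :: (type, real_vector) real_vector
begin
definition scaleR_fun :: "real \<Rightarrow> ('a \<Rightarrow> 'b) \<Rightarrow> 'a \<Rightarrow> 'b" where
  "scaleR_fun r f = (\<lambda>x. r *\<^sub>R f x)"
instance
  by standard (auto simp: scaleR_fun_def fun_eq_iff scaleR_add_right scaleR_add_left)
end

text \<open>Permutations of [n] in one-line notation, as lists of naturals.\<close>
definition perms :: "nat \<Rightarrow> nat list set" where
  "perms n = {xs. distinct xs \<and> set xs = {1..n}}"

definition std :: "nat list \<Rightarrow> nat list" where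
  "std xs = map (\<lambda>x. card {y \<in> set xs. y \<le> x}) xs"

definition pat :: "nat set \<Rightarrow> nat list \<Rightarrow> nat list" where
  "pat I \<sigma> = std (nths \<sigma> I)"

definition avoids :: "nat list \<Rightarrow> nat list \<Rightarrow> bool" where
  "avoids \<sigma> \<pi> \<longleftrightarrow> \<not> (\<exists>I. I \<subseteq> {0..<length \<sigma>} \<and> pat I \<sigma> = \<pi>)"

definition Av_n :: "nat \<Rightarrow> nat list set \<Rightarrow> nat list set" where
  "Av_n n B = {\<sigma> \<in> perms n. \<forall>\<pi>\<in>B. avoids \<sigma> \<pi>}"

definition Av :: "nat list set \<Rightarrow> nat list set" where
  "Av B = (\<Union>n\<in>{1..}. Av_n n B)"

definition c_occ :: "nat list \<Rightarrow> nat list \<Rightarrow> nat" where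
  "c_occ \<pi> \<sigma> = card {i. i + length \<pi> \<le> length \<sigma> \<and>
                          pat {i..<i + length \<pi>} \<sigma> = \<pi>}"

definition c_occ_prop :: "nat list \<Rightarrow> nat list \<Rightarrow> real" where
  "c_occ_prop \<pi> \<sigma> = real (c_occ \<pi> \<sigma>) / real (length \<sigma>)"

definition feasible_region :: "nat \<Rightarrow> nat list set \<Rightarrow> (nat list \<Rightarrow> real) set" where
  "feasible_region k B = {v. (\<forall>\<pi>. \<pi> \<notin> perms k \<longrightarrow> v \<pi> = 0) \<and>
      (\<forall>\<pi>\<in>perms k. 0 \<le> v \<pi> \<and> v \<pi> \<le> 1) \<and>
      (\<exists>s :: nat \<Rightarrow> nat list. (\<forall>m. s m \<in> Av B) \<and>
         filterlim (\<lambda>m. length (s m)) at_top sequentially \<and>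
         (\<forall>\<pi>\<in>perms k. (\<lambda>m. c_occ_prop \<pi> (s m)) \<longlonglongrightarrow> v \<pi>))}"

text \<open>Vertices of Ov(k, Av(B)) are Av_{k-1}(B); edges are the elements of Av_k(B),
  the edge pi going from ov_src pi to ov_tgt pi.\<close>
definition ov_src :: "nat \<Rightarrow> nat list \<Rightarrow> nat list" where
  "ov_src k \<pi> = pat {0..<k - 1} \<pi>"

definition ov_tgt :: "nat \<Rightarrow> nat list \<Rightarrow> nat list" where
  "ov_tgt k \<pi> = pat {1..<k} \<pi>"

text \<open>A simple cycle, given as the (nonempty) list of its edges e_0,...,e_{m-1}
  in order; consecutive edges (cyclically) are composable, the visited vertices
  (the sources) are distinct and the edges are distinct.\<close>
definition simple_cycle :: "nat \<Rightarrow> nat list set \<Rightarrow> nat list list \<Rightarrow> bool" where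
  "simple_cycle k B cs \<longleftrightarrow> cs \<noteq> [] \<and> set cs \<subseteq> Av_n k B \<and>
     set (map (ov_src k) cs) \<subseteq> Av_n (k - 1) B \<and>
     (\<forall>i < length cs. ov_tgt k (cs ! i) = ov_src k (cs ! ((i + 1) mod length cs))) \<and>
     distinct (map (ov_src k) cs) \<and> distinct cs"

definition cycle_vec :: "nat list list \<Rightarrow> (nat list \<Rightarrow> real)" where
  "cycle_vec cs = (\<lambda>\<pi>. real (count_list cs \<pi>) / real (length cs))"

definition cycle_polytope :: "nat \<Rightarrow> nat list set \<Rightarrow> (nat list \<Rightarrow> real) set" where
  "cycle_polytope k B = convex hull {cycle_vec cs | cs. simple_cycle k B cs}"

definition affine_dim :: "'a::real_vector set \<Rightarrow> nat" where
  "affine_dim S = dim {x - y | x y. x \<in> S \<and> y \<in> S}"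

definition catalan :: "nat \<Rightarrow> nat" where
  "catalan n = ((2 * n) choose n) div (n + 1)"

end

theory Submission
  imports Defs
begin

text \<open>
  The limit of the window frequencies of long 312-avoiding permutations is a unit circulation on the
  overlap graph, because consecutive windows trace a walk and its divergence telescopes. Unit
  circulations decompose into simple cycles, and a circulation supported on a single simple cycle is
  unique, so the simple cycles are the vertices of the circulation polytope.

  Conversely, every walk of the overlap graph is realised by a 312-avoiding permutation: to append
  the next edge, place the new last value immediately below the next larger value of the current
  window. Since 312-avoiding permutations are closed under direct sums, convex combinations of cycles
  are feasible too.

  For the dimension, the direct sums \<open>u \<oplus> r\<close> give walks between any two vertices, which makes the
  divergences at all vertices but one, together with the total mass, linearly independent
  functionals; closed walks \<open>\<pi> \<oplus> src \<pi>\<close> give a positive circulation. Hence the dimension is the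
  number of edges minus the number of vertices, and both numbers are Catalan numbers by the
  generating tree of 312-avoiding permutations.
\<close>

subsection \<open>Standardisation and windows\<close>

text \<open>The polytope of unit circulations is where the three claims meet: its equations are what
  limits of frequencies inherit, peeling off cycles yields its generators, and its dimension is a
  rank computation. Cycle arguments and linear algebra therefore live in an abstract graph
  \<open>E\<close>, \<open>s\<close>, \<open>t\<close>; only realisation, direct sums and counting
  use the pattern 312. A single permutation need not give a circulation: its walk has two loose
  ends, and a direct sum has a seam. Both defects are bounded independently of the length, so they
  vanish after division by it. This is why approximation is stated with additive errors. For the
  dimension, a set given by equations and nonnegativity may be smaller than its equations suggest,
  when some coordinate is forced to be 0. A circulation positive on every edge excludes this. One
  divergence has to be left out because all divergences add up to 0.\<close>

lemma std_eq_map_strict_mono: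
  obtains f where "strict_mono_on (set xs) f" "std xs = map f xs"
proof
  let ?f = "\<lambda>x. card {y \<in> set xs. y \<le> x}"
  show "strict_mono_on (set xs) ?f"
  proof (rule strict_mono_onI)
    fix r s assume "r \<in> set xs" "s \<in> set xs" "r < s"
    then have "{y \<in> set xs. y \<le> r} \<subset> {y \<in> set xs. y \<le> s}" by force
    then show "?f r < ?f s" by (intro psubset_card_mono) auto
  qed
  show "std xs = map ?f xs" by (simp add: std_def)
qed

lemma std_map_strict_mono:
  assumes "strict_mono_on (set xs) f"
  shows "std (map f xs) = std xs"
proof -
  have inj: "inj_on f (set xs)" by (rule strict_mono_on_imp_inj_on[OF assms])
  have "card {y \<in> f ` set xs. y \<le> f x} = card {y \<in> set xs. y \<le> x}" if "x \<in> set xs" for x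
  proof -
    have "{y \<in> f ` set xs. y \<le> f x} = f ` {y \<in> set xs. y \<le> x}"
      using that by (auto simp: strict_mono_on_less_eq[OF assms])
    moreover have "inj_on f {y \<in> set xs. y \<le> x}" by (rule inj_on_subset[OF inj]) auto
    ultimately show ?thesis by (simp add: card_image)
  qed
  then show ?thesis by (simp add: std_def)
qed

lemma length_std [simp]: "length (std xs) = length xs"
  by (simp add: std_def)

lemma std_nth_less_iff:
  assumes "i < length xs" "j < length xs"
  shows "std xs ! i < std xs ! j \<longleftrightarrow> xs ! i < xs ! j"
proof -
  obtain f where f: "strict_mono_on (set xs) f" "std xs = map f xs"
    by (rule std_eq_map_strict_mono)
  then show ?thesis using strict_mono_on_less[OF f(1)] assms by simp
qed

lemma std_in_perms:
  assumes "distinct xs"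
  shows "std xs \<in> perms (length xs)"
proof -
  obtain f where f: "strict_mono_on (set xs) f" "std xs = map f xs"
    by (rule std_eq_map_strict_mono)
  have d: "distinct (std xs)"
    using assms f strict_mono_on_imp_inj_on by (auto simp: distinct_map)
  have "set (std xs) \<subseteq> {1..length xs}"
  proof
    fix y assume "y \<in> set (std xs)"
    then obtain x where x: "x \<in> set xs" "y = card {z \<in> set xs. z \<le> x}"
      by (auto simp: std_def)
    have "card {z \<in> set xs. z \<le> x} \<le> card (set xs)" by (intro card_mono) auto
    moreover have "card {z \<in> set xs. z \<le> x} > 0" using x(1) by (auto simp: card_gt_0_iff)
    ultimately show "y \<in> {1..length xs}" using x card_length[of xs] by simp
  qed
  moreover have "card (set (std xs)) = card {1..length xs}"
    using distinct_card[OF d] by simp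
  ultimately have "set (std xs) = {1..length xs}" by (intro card_subset_eq) auto
  then show ?thesis using d by (simp add: perms_def)
qed

lemma length_perms: "xs \<in> perms n \<Longrightarrow> length xs = n"
  unfolding perms_def using distinct_card by fastforce

lemma std_perms:
  assumes "xs \<in> perms n"
  shows "std xs = xs"
proof -
  have "card {y \<in> set xs. y \<le> x} = x" if "x \<in> set xs" for x
  proof -
    have "{y \<in> set xs. y \<le> x} = {1..x}" using that assms by (auto simp: perms_def)
    then show ?thesis by simp
  qed
  then show ?thesis by (simp add: std_def map_idI)
qed

text \<open>With distinct entries, the rank of \<open>xs ! i\<close> is the number of positions
  \<open>j\<close> with \<open>\<not> xs ! i < xs ! j\<close>, and that number sees only comparisons
  between positions.\<close>

lemma std_cong:
  assumes "distinct xs" "distinct ys" "length xs = length ys"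
    and "\<And>i j. i < length xs \<Longrightarrow> j < length xs \<Longrightarrow> xs ! i < xs ! j \<longleftrightarrow> ys ! i < ys ! j"
  shows "std xs = std ys"
proof (rule nth_equalityI)
  have *: "card {y \<in> set zs. y \<le> zs ! i} = card {j. j < length zs \<and> \<not> zs ! i < zs ! j}"
    if "distinct zs" for i and zs :: "nat list"
  proof -
    have "{y \<in> set zs. y \<le> zs ! i} = (!) zs ` {j. j < length zs \<and> \<not> zs ! i < zs ! j}"
      by (auto simp: in_set_conv_nth)
    moreover have "inj_on ((!) zs) {j. j < length zs \<and> \<not> zs ! i < zs ! j}"
      by (rule inj_on_nth[OF that]) auto
    ultimately show ?thesis by (simp add: card_image)
  qed
  fix i assume i: "i < length (std xs)"
  have "{j. j < length xs \<and> \<not> xs ! i < xs ! j} = {j. j < length ys \<and> \<not> ys ! i < ys ! j}"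
    using assms i by auto
  then show "std xs ! i = std ys ! i"
    using i assms(3) *[OF assms(1)] *[OF assms(2)] by (simp add: std_def)
qed (simp add: assms)

text \<open>The \<open>take\<close>/\<open>drop\<close> form of \<open>pat {i..<i + k}\<close>, with
  0-based start \<open>i\<close>. A window running past the end is cut short, hence the bounds
  \<open>i + k \<le> length \<sigma>\<close> below.\<close>

definition win :: "nat \<Rightarrow> nat list \<Rightarrow> nat \<Rightarrow> nat list" where
  "win k \<sigma> i = std (take k (drop i \<sigma>))"

lemma pat_interval: "pat {i..<i + k} \<sigma> = win k \<sigma> i"
proof -
  have "{i..<i + k} = (+) i ` {..<k}" by (simp add: lessThan_atLeast0 add.commute)
  then have "nths \<sigma> {i..<i + k} = take k (drop i \<sigma>)"
    by (metis nths_drop nths_upt_eq_take)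
  then show ?thesis by (simp add: pat_def win_def)
qed

lemma win_map_strict_mono:
  assumes "strict_mono_on (set \<sigma>) f"
  shows "win k (map f \<sigma>) i = win k \<sigma> i"
proof -
  have "set (take k (drop i \<sigma>)) \<subseteq> set \<sigma>"
    by (meson set_drop_subset set_take_subset subset_trans)
  then have "strict_mono_on (set (take k (drop i \<sigma>))) f"
    using assms monotone_on_subset by blast
  then show ?thesis by (simp add: win_def take_map drop_map std_map_strict_mono)
qed

lemma win_std: "win k (std \<sigma>) i = win k \<sigma> i"
  by (metis std_eq_map_strict_mono win_map_strict_mono)

text \<open>With \<open>j = k - 1\<close> and \<open>i\<close> equal to 0 or 1: the source and
  target of the edge read at \<open>m\<close> are the shorter windows at \<open>m\<close> and
  \<open>m + 1\<close>.\<close>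

lemma win_win:
  assumes "i + j \<le> k"
  shows "win j (win k \<sigma> m) i = win j \<sigma> (m + i)"
proof -
  have "win j (win k \<sigma> m) i = win j (take k (drop m \<sigma>)) i"
    by (simp add: win_def[of k] win_std)
  also have "take j (drop i (take k (drop m \<sigma>))) = take j (drop (m + i) \<sigma>)"
    using assms by (simp add: drop_take min_def add.commute)
  then have "win j (take k (drop m \<sigma>)) i = win j \<sigma> (m + i)" by (simp add: win_def)
  finally show ?thesis .
qed

lemma win_append1: "i + k \<le> length \<sigma> \<Longrightarrow> win k (\<sigma> @ \<tau>) i = win k \<sigma> i"
  by (simp add: win_def)

lemma win_in_perms: "distinct \<sigma> \<Longrightarrow> i + k \<le> length \<sigma> \<Longrightarrow> win k \<sigma> i \<in> perms k"
  unfolding win_def using std_in_perms[of "take k (drop i \<sigma>)"] by simp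

lemma win_perms: "\<sigma> \<in> perms k \<Longrightarrow> win k \<sigma> 0 = \<sigma>"
  by (simp add: win_def length_perms std_perms)

lemma ov_src_eq: "ov_src k \<pi> = win (k - 1) \<pi> 0"
  using pat_interval[of 0 "k - 1"] by (simp add: ov_src_def)

lemma ov_tgt_eq: "k \<ge> 1 \<Longrightarrow> ov_tgt k \<pi> = win (k - 1) \<pi> 1"
  using pat_interval[of 1 "k - 1"] by (simp add: ov_tgt_def)

lemma c_occ_eq: "\<pi> \<in> perms k \<Longrightarrow> c_occ \<pi> \<sigma> = card {i. i + k \<le> length \<sigma> \<and> win k \<sigma> i = \<pi>}"
  by (simp add: c_occ_def pat_interval length_perms)

section \<open>Occurrences of 312 by positions\<close>

definition has312 :: "nat list \<Rightarrow> bool" where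
  "has312 xs \<longleftrightarrow> (\<exists>i j l. i < j \<and> j < l \<and> l < length xs \<and> xs ! j < xs ! l \<and> xs ! l < xs ! i)"

lemma has312_map_iff:
  assumes "strict_mono_on (set xs) f"
  shows "has312 (map f xs) \<longleftrightarrow> has312 xs"
  unfolding has312_def
  by (auto simp: strict_mono_on_less[OF assms] cong: conj_cong)

lemma has312_take_drop:
  assumes "has312 (take k (drop i xs))"
  shows "has312 xs"
proof -
  obtain a b c where "a < b" "b < c" "c < k" "i + c < length xs"
    "xs ! (i + b) < xs ! (i + c)" "xs ! (i + c) < xs ! (i + a)"
    using assms by (auto simp: has312_def)
  then show ?thesis unfolding has312_def by (meson add_less_cancel_left)
qed

lemma has312_win: "has312 (win k \<sigma> i) \<Longrightarrow> has312 \<sigma>"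
  unfolding win_def
  by (metis has312_map_iff has312_take_drop std_eq_map_strict_mono)

text \<open>An occurrence inside \<open>nths \<sigma> I\<close> is carried back to \<sigma> along
  the increasing enumeration \<open>g\<close> of the selected positions; conversely, the three
  positions of an occurrence form a suitable \<open>I\<close>.\<close>

lemma avoids_312_iff: "avoids \<sigma> [3, 1, 2] \<longleftrightarrow> \<not> has312 \<sigma>"
proof -
  have "has312 \<sigma>" if "pat I \<sigma> = [3, 1, 2]" for I
  proof -
    have h: "has312 (nths \<sigma> I)"
    proof -
      have "has312 [3, 1, 2]" unfolding has312_def
        by (intro exI[of _ 0] exI[of _ 1] exI[of _ 2]) simp
      then show ?thesis using that
        by (metis has312_map_iff pat_def std_eq_map_strict_mono)
    qed
    obtain a b c where abc: "a < b" "b < c" "c < length (nths \<sigma> I)"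
      "nths \<sigma> I ! b < nths \<sigma> I ! c" "nths \<sigma> I ! c < nths \<sigma> I ! a"
      using h by (auto simp: has312_def)
    have "\<exists>g. strict_mono_on {..<length (nths xs I)} g \<and>
        (\<forall>i<length (nths xs I). g i < length xs \<and> nths xs I ! i = xs ! g i)" for xs :: "nat list"
    proof (induction xs rule: rev_induct)
      case Nil
      then show ?case by simp
    next
      case (snoc x xs)
      then obtain g where g: "strict_mono_on {..<length (nths xs I)} g"
        "\<forall>i<length (nths xs I). g i < length xs \<and> nths xs I ! i = xs ! g i" by blast
      show ?case
      proof (cases "length xs \<in> I")
        case True
        then have n: "nths (xs @ [x]) I = nths xs I @ [x]" by (simp add: nths_append)
        show ?thesis unfolding n using g
          by (intro exI[of _ "g(length (nths xs I) := length xs)"])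
            (auto simp: strict_mono_on_def nth_append less_Suc_eq)
      next
        case False
        then have n: "nths (xs @ [x]) I = nths xs I" by (simp add: nths_append)
        show ?thesis unfolding n using g
          by (intro exI[of _ g]) (auto simp: nth_append less_Suc_eq)
      qed
    qed
    then obtain g where g: "strict_mono_on {..<length (nths \<sigma> I)} g"
      "\<forall>i<length (nths \<sigma> I). g i < length \<sigma> \<and> nths \<sigma> I ! i = \<sigma> ! g i" by blast
    have "g a < g b" "g b < g c"
      using strict_mono_onD[OF g(1)] abc by auto
    moreover have "g c < length \<sigma>" "\<sigma> ! g b < \<sigma> ! g c" "\<sigma> ! g c < \<sigma> ! g a"
      using g(2) abc by (auto dest: less_trans)
    ultimately show ?thesis unfolding has312_def by blast
  qed
  moreover have "\<exists>I. I \<subseteq> {0..<length \<sigma>} \<and> pat I \<sigma> = [3, 1, 2]" if h: "has312 \<sigma>"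
  proof -
    obtain a b c where abc: "a < b" "b < c" "c < length \<sigma>" "\<sigma> ! b < \<sigma> ! c" "\<sigma> ! c < \<sigma> ! a"
      using h by (auto simp: has312_def)
    \<comment> \<open>Splitting at the three positions lets \<open>nths\<close> be computed block by
      block; the blocks in between contribute nothing.\<close>
    have id: "\<sigma> = take a \<sigma> @ \<sigma> ! a # take (b - a - 1) (drop (Suc a) \<sigma>) @ \<sigma> ! b #
      take (c - b - 1) (drop (Suc b) \<sigma>) @ \<sigma> ! c # drop (Suc c) \<sigma>"
    proof -
      have "drop (Suc b) \<sigma> = take (c - b - 1) (drop (Suc b) \<sigma>) @ drop c \<sigma>"
        using abc append_take_drop_id[of "c - b - 1" "drop (Suc b) \<sigma>"] by simp
      moreover have "drop (Suc a) \<sigma> = take (b - a - 1) (drop (Suc a) \<sigma>) @ drop b \<sigma>"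
        using abc append_take_drop_id[of "b - a - 1" "drop (Suc a) \<sigma>"] by simp
      ultimately show ?thesis
        using abc id_take_nth_drop[of a \<sigma>] Cons_nth_drop_Suc[of b \<sigma>] Cons_nth_drop_Suc[of c \<sigma>]
        by simp
    qed
    have none: "nths xs J = []" if "\<forall>i<length xs. i \<notin> J" for xs :: "nat list" and J
      using that by (force simp: set_nths simp flip: set_empty)
    have "nths (take (b - Suc a) (drop (Suc a) \<sigma>)) {j. Suc (j + a) = b \<or> Suc (j + a) = c} = []"
      "nths (take (c - Suc b) (drop (Suc b) \<sigma>)) {j. Suc (j + b) = c} = []"
      using abc by (auto intro!: none)
    then have "nths \<sigma> {a, b, c} = [\<sigma> ! a, \<sigma> ! b, \<sigma> ! c]"
      using abc by (subst id) (simp add: nths_append nths_Cons none)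
    then have "pat {a, b, c} \<sigma> = std [\<sigma> ! a, \<sigma> ! b, \<sigma> ! c]" by (simp add: pat_def)
    also have "\<dots> = [3, 1, 2]"
    proof -
      have "{y. (y = \<sigma> ! a \<or> y = \<sigma> ! b \<or> y = \<sigma> ! c) \<and> y \<le> \<sigma> ! a} = {\<sigma> ! a, \<sigma> ! b, \<sigma> ! c}"
        "{y. (y = \<sigma> ! a \<or> y = \<sigma> ! b \<or> y = \<sigma> ! c) \<and> y \<le> \<sigma> ! b} = {\<sigma> ! b}"
        "{y. (y = \<sigma> ! a \<or> y = \<sigma> ! b \<or> y = \<sigma> ! c) \<and> y \<le> \<sigma> ! c} = {\<sigma> ! b, \<sigma> ! c}"
        using abc by auto
      then show ?thesis using abc by (simp add: std_def)
    qed
    finally show ?thesis using abc by (intro exI[of _ "{a, b, c}"]) auto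
  qed
  ultimately show ?thesis by (auto simp: avoids_def)
qed

lemma Av_n_312: "Av_n n {[3, 1, 2]} = {\<sigma> \<in> perms n. \<not> has312 \<sigma>}"
  by (simp only: Av_n_def ball_simps avoids_312_iff simp_thms)

subsection \<open>Realising walks by 312-avoiding permutations\<close>

definition av312 :: "nat \<Rightarrow> nat list set" where
  "av312 n = {\<sigma> \<in> perms n. \<not> has312 \<sigma>}"

lemma av312_0: "av312 0 = {[]}"
  by (auto simp: av312_def perms_def has312_def)

lemma length_av312: "\<sigma> \<in> av312 n \<Longrightarrow> length \<sigma> = n"
  by (simp add: av312_def length_perms)

lemma distinct_av312: "\<sigma> \<in> av312 n \<Longrightarrow> distinct \<sigma>"
  by (simp add: av312_def perms_def)

lemma set_av312: "\<sigma> \<in> av312 n \<Longrightarrow> set \<sigma> = {1..n}"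
  by (simp add: av312_def perms_def)

lemma finite_perms: "finite (perms n)"
proof (rule finite_subset)
  show "perms n \<subseteq> {xs. set xs \<subseteq> {1..n} \<and> length xs = n}"
    using length_perms by (auto simp: perms_def)
qed (simp add: finite_lists_length_eq)

lemma finite_av312: "finite (av312 n)"
  using finite_perms by (simp add: av312_def)

lemma win_in_av312: "\<sigma> \<in> av312 n \<Longrightarrow> i + k \<le> n \<Longrightarrow> win k \<sigma> i \<in> av312 k"
  using win_in_perms[of \<sigma> i k] has312_win[of k \<sigma> i] distinct_av312[of \<sigma> n] length_av312[of \<sigma> n]
  by (auto simp: av312_def)

section \<open>Appending a new last value\<close>

definition bump :: "nat \<Rightarrow> nat \<Rightarrow> nat" where
  "bump x y = (if x \<le> y then Suc y else y)"

definition ins :: "nat \<Rightarrow> nat list \<Rightarrow> nat list" where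
  "ins x \<sigma> = map (bump x) \<sigma> @ [x]"

text \<open>Once \<open>bump x\<close> has raised the values that are at least \<open>x\<close>, the
  entries at \<open>i\<close> and \<open>j\<close> act as 3 and 1 and the appended \<open>x\<close>
  as 2. Hence the weak inequality at \<open>i\<close>.\<close>

definition crossed :: "nat list \<Rightarrow> nat \<Rightarrow> bool" where
  "crossed \<sigma> x \<longleftrightarrow> (\<exists>i j. i < j \<and> j < length \<sigma> \<and> \<sigma> ! j < x \<and> x \<le> \<sigma> ! i)"

lemma strict_mono_on_bump: "strict_mono_on A (bump x)"
  by (auto simp: strict_mono_on_def bump_def)

lemma inj_bump: "inj (bump x)"
  by (rule strict_mono_on_imp_inj_on[OF strict_mono_on_bump])

lemma length_ins [simp]: "length (ins x \<sigma>) = Suc (length \<sigma>)"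
  by (simp add: ins_def)

lemma ins_in_perms:
  assumes "\<sigma> \<in> perms n" "x \<in> {1..Suc n}"
  shows "ins x \<sigma> \<in> perms (Suc n)"
proof -
  have "y \<in> bump x ` {1..n}" if "y \<in> {1..Suc n}" "y \<noteq> x" for y
  proof (cases "y < x")
    case True
    then show ?thesis using that assms by (intro image_eqI[of _ _ y]) (auto simp: bump_def)
  next
    case False
    then show ?thesis using that assms by (intro image_eqI[of _ _ "y - 1"]) (auto simp: bump_def)
  qed
  moreover have "bump x y \<in> {1..Suc n}" "bump x y \<noteq> x" if "y \<in> {1..n}" for y
    using that by (auto simp: bump_def)
  ultimately have "insert x (bump x ` {1..n}) = {1..Suc n}" using assms by blast
  moreover have "x \<notin> bump x ` {1..n}" by (auto simp: bump_def)
  ultimately show ?thesis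
    using assms inj_bump by (auto simp: perms_def ins_def distinct_map inj_on_def)
qed

lemma has312_snoc:
  "has312 (xs @ [x]) \<longleftrightarrow> has312 xs \<or> (\<exists>i j. i < j \<and> j < length xs \<and> xs ! j < x \<and> x < xs ! i)"
  unfolding has312_def
proof (intro iffI; elim disjE exE conjE)
  fix i j l
  assume "i < j" "j < l" "l < length (xs @ [x])" "(xs @ [x]) ! j < (xs @ [x]) ! l"
    "(xs @ [x]) ! l < (xs @ [x]) ! i"
  then show "(\<exists>i j l. i < j \<and> j < l \<and> l < length xs \<and> xs ! j < xs ! l \<and> xs ! l < xs ! i) \<or>
    (\<exists>i j. i < j \<and> j < length xs \<and> xs ! j < x \<and> x < xs ! i)"
    by (cases "l < length xs") (auto simp: nth_append less_Suc_eq; blast)+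
next
  fix i j l
  assume "i < j" "j < l" "l < length xs" "xs ! j < xs ! l" "xs ! l < xs ! i"
  then show "\<exists>i j l. i < j \<and> j < l \<and> l < length (xs @ [x]) \<and> (xs @ [x]) ! j < (xs @ [x]) ! l \<and>
    (xs @ [x]) ! l < (xs @ [x]) ! i"
    by (intro exI[of _ i] exI[of _ j] exI[of _ l]) (simp add: nth_append)
next
  fix i j
  assume "i < j" "j < length xs" "xs ! j < x" "x < xs ! i"
  then show "\<exists>i j l. i < j \<and> j < l \<and> l < length (xs @ [x]) \<and> (xs @ [x]) ! j < (xs @ [x]) ! l \<and>
    (xs @ [x]) ! l < (xs @ [x]) ! i"
    by (intro exI[of _ i] exI[of _ j] exI[of _ "length xs"]) (simp add: nth_append)
qed

lemma has312_ins: "has312 (ins x \<sigma>) \<longleftrightarrow> has312 \<sigma> \<or> crossed \<sigma> x"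
proof -
  have "bump x y < x \<longleftrightarrow> y < x" "x < bump x y \<longleftrightarrow> x \<le> y" for y
    by (auto simp: bump_def)
  then show ?thesis
    unfolding ins_def has312_snoc crossed_def has312_map_iff[OF strict_mono_on_bump]
    by (auto cong: conj_cong)
qed

lemma win_ins: "i + k \<le> length \<sigma> \<Longrightarrow> win k (ins x \<sigma>) i = win k \<sigma> i"
  by (simp add: ins_def win_append1 win_map_strict_mono[OF strict_mono_on_bump])

text \<open>The new last value is placed immediately below the next larger value of the window, so
  that a forbidden pattern ending in it would produce one in \<open>\<pi>\<close> or in \<open>\<sigma>\<close>.\<close>
lemma av312_extend_by_edge:
  assumes \<sigma>: "\<sigma> \<in> av312 n" and "h \<le> n" and \<pi>: "\<pi> \<in> av312 (Suc h)"
    and eq: "win h \<sigma> (n - h) = win h \<pi> 0"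
  obtains x where "ins x \<sigma> \<in> av312 (Suc n)" "win (Suc h) (ins x \<sigma>) (n - h) = \<pi>"
proof -
  define w where "w = drop (n - h) \<sigma>"
  note len = length_av312[OF \<sigma>] length_av312[OF \<pi>]
  have lw: "length w = h" using len \<open>h \<le> n\<close> by (simp add: w_def)
  have w_nth: "w ! i = \<sigma> ! (n - h + i)" if "i < h" for i
    using that len \<open>h \<le> n\<close> by (simp add: w_def)
  have "std w = std (take h \<pi>)" using eq lw by (simp add: win_def w_def)
  then have iso: "w ! i < w ! j \<longleftrightarrow> \<pi> ! i < \<pi> ! j" if "i < h" "j < h" for i j
    using that std_nth_less_iff[of i w j] std_nth_less_iff[of i "take h \<pi>" j] lw len by simp
  have neq: "\<pi> ! i \<noteq> \<pi> ! h" if "i < h" for i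
    using distinct_av312[OF \<pi>] that len by (simp add: nth_eq_iff_index_eq)
  define U where "U = {i. i < h \<and> \<pi> ! h < \<pi> ! i}"
  \<comment> \<open>\<open>Suc n\<close> is the default when the last entry of \<pi> is its maximum.
    Otherwise \<open>x\<close> is itself a value of the window; this last clause supplies the third
    entry of the patterns that refute a crossing.\<close>
  have "\<exists>x \<in> {1..Suc n}. (\<forall>i<h. x \<le> w ! i \<longleftrightarrow> \<pi> ! h < \<pi> ! i) \<and> (x = Suc n \<or> (\<exists>i\<in>U. x = w ! i))"
  proof (cases "U = {}")
    case True
    have "w ! i \<le> n" if "i < h" for i
    proof -
      have "w ! i \<in> set \<sigma>" using that lw nth_mem[of i w] by (auto simp: w_def dest: in_set_dropD)
      then show ?thesis using set_av312[OF \<sigma>] by simp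
    qed
    then show ?thesis using True by (intro bexI[of _ "Suc n"]) (fastforce simp: U_def)+
  next
    case False
    define x where "x = Min ((!) w ` U)"
    have fin: "finite ((!) w ` U)" by (simp add: U_def)
    have "x \<in> (!) w ` U" unfolding x_def using fin False by (intro Min_in) auto
    then obtain i0 where i0: "i0 \<in> U" "x = w ! i0" by blast
    have "x \<in> set \<sigma>" using i0 lw nth_mem[of i0 w] by (auto simp: w_def U_def dest: in_set_dropD)
    then have "x \<in> {1..Suc n}" using set_av312[OF \<sigma>] by simp
    moreover have "x \<le> w ! i \<longleftrightarrow> \<pi> ! h < \<pi> ! i" if "i < h" for i
    proof
      assume "x \<le> w ! i"
      then have "\<not> \<pi> ! i < \<pi> ! i0" using iso[of i i0] that i0 by (simp add: U_def)
      then show "\<pi> ! h < \<pi> ! i" using i0 by (simp add: U_def)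
    next
      assume "\<pi> ! h < \<pi> ! i"
      then show "x \<le> w ! i" unfolding x_def using that fin by (intro Min_le) (auto simp: U_def)
    qed
    ultimately show ?thesis using i0 by blast
  qed
  then obtain x where x: "x \<in> {1..Suc n}" "\<And>i. i < h \<Longrightarrow> x \<le> w ! i \<longleftrightarrow> \<pi> ! h < \<pi> ! i"
    "x = Suc n \<or> (\<exists>i\<in>U. x = w ! i)" by blast
  have "\<not> crossed \<sigma> x"
  proof
    assume "crossed \<sigma> x"
    then obtain i j where ij: "i < j" "j < n" "\<sigma> ! j < x" "x \<le> \<sigma> ! i"
      using len by (auto simp: crossed_def)
    have "\<sigma> ! i \<le> n" using set_av312[OF \<sigma>] ij len nth_mem[of i \<sigma>] by simp
    then obtain i0 where i0: "i0 < h" "\<pi> ! h < \<pi> ! i0" "x = w ! i0"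
      using x(3) ij by (auto simp: U_def)
    define q where "q = n - h + i0"
    have q: "\<sigma> ! q = x" "q < n" using i0 w_nth \<open>h \<le> n\<close> by (auto simp: q_def)
    \<comment> \<open>If the small entry \<open>j\<close> precedes \<open>q\<close>, then
      \<open>i\<close>, \<open>j\<close>, \<open>q\<close> form a 312 in \<sigma>. If it follows
      \<open>q\<close>, it lies in the window, and \<open>i0\<close>, \<open>j0\<close>,
      \<open>h\<close> form a 312 in \<pi>.\<close>
    show False
    proof (cases "j < q")
      case True
      have "\<sigma> ! i \<noteq> \<sigma> ! q"
        using nth_eq_iff_index_eq[OF distinct_av312[OF \<sigma>], of i q] True ij q len by simp
      then have "\<sigma> ! q < \<sigma> ! i" using ij q by simp
      then have "has312 \<sigma>" unfolding has312_def using True ij q len by blast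
      then show False using \<sigma> by (simp add: av312_def)
    next
      case False
      then have jq: "q < j" using ij q by (cases "j = q") auto
      define j0 where "j0 = j - (n - h)"
      have j0: "i0 < j0" "j0 < h" "j = n - h + j0" using jq ij by (auto simp: j0_def q_def)
      have "\<not> x \<le> w ! j0" using ij j0 w_nth by simp
      then have "\<pi> ! j0 < \<pi> ! h" using x(2)[of j0] neq[of j0] j0 by linarith
      then have "has312 \<pi>" unfolding has312_def using j0 i0 len by auto
      then show False using \<pi> by (simp add: av312_def)
    qed
  qed
  then have *: "ins x \<sigma> \<in> av312 (Suc n)"
    using \<sigma> ins_in_perms x(1) by (simp add: av312_def has312_ins)
  have dr: "drop (n - h) (ins x \<sigma>) = map (bump x) w @ [x]"
    using len by (simp add: ins_def w_def drop_map)
  have "std (map (bump x) w @ [x]) = std \<pi>"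
  proof (rule std_cong)
    show "distinct (map (bump x) w @ [x])"
      using distinct_av312[OF *] dr by (metis distinct_drop)
    show "distinct \<pi>" using distinct_av312[OF \<pi>] .
    show "length (map (bump x) w @ [x]) = length \<pi>" using lw len by simp
    have b: "bump x y < bump x z \<longleftrightarrow> y < z" "x < bump x y \<longleftrightarrow> x \<le> y" "bump x y < x \<longleftrightarrow> \<not> x \<le> y" for y z
      by (auto simp: bump_def)
    have lt: "\<pi> ! i < \<pi> ! h \<longleftrightarrow> \<not> x \<le> w ! i" if "i < h" for i
      using x(2)[OF that] neq[OF that] by linarith
    fix i j assume "i < length (map (bump x) w @ [x])" "j < length (map (bump x) w @ [x])"
    then have ij: "i < h \<or> i = h" "j < h \<or> j = h" using lw by auto
    show "(map (bump x) w @ [x]) ! i < (map (bump x) w @ [x]) ! j \<longleftrightarrow> \<pi> ! i < \<pi> ! j"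
      using ij lw by (elim disjE) (simp_all add: nth_append b iso lt x(2))
  qed
  then have "win (Suc h) (ins x \<sigma>) (n - h) = \<pi>"
    using \<pi> dr lw std_perms[of \<pi> "Suc h"] by (simp add: win_def av312_def)
  then show thesis using * that by blast
qed

text \<open>The last window of length \<open>h\<close> is the target of the last edge, hence the
  source of the next one, so one more value can be appended. Earlier windows survive because
  \<open>bump\<close> preserves their relative order.\<close>

lemma av312_realise_walk:
  assumes e: "\<And>i. e i \<in> av312 (Suc h)" and step: "\<And>i. win h (e i) 1 = win h (e (Suc i)) 0"
  shows "\<exists>\<sigma>\<in>av312 (N + Suc h). \<forall>i\<le>N. win (Suc h) \<sigma> i = e i"
proof (induction N)
  case 0
  have "e 0 \<in> perms (Suc h)" using e[of 0] by (simp add: av312_def)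
  then show ?case using e by (intro bexI[of _ "e 0"]) (simp_all add: win_perms)
next
  case (Suc N)
  then obtain \<sigma> where \<sigma>: "\<sigma> \<in> av312 (N + Suc h)" "\<forall>i\<le>N. win (Suc h) \<sigma> i = e i" by blast
  have "win h \<sigma> (N + 1) = win h (win (Suc h) \<sigma> N) 1" by (simp add: win_win)
  then have "win h \<sigma> (N + Suc h - h) = win h (e (Suc N)) 0" using \<sigma> step by simp
  then obtain x where x: "ins x \<sigma> \<in> av312 (Suc (N + Suc h))"
    "win (Suc h) (ins x \<sigma>) (N + Suc h - h) = e (Suc N)"
    using av312_extend_by_edge[OF \<sigma>(1) _ e] by (metis le_add2 le_SucI add_Suc_right)
  have "win (Suc h) (ins x \<sigma>) i = e i" if "i \<le> Suc N" for i
  proof (cases "i = Suc N")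
    case False
    then show ?thesis using that \<sigma> by (simp add: win_ins length_av312)
  qed (use x in simp)
  then show ?case using x(1) by (intro bexI[of _ "ins x \<sigma>"]) auto
qed

section \<open>Direct sums\<close>

definition osum :: "nat list \<Rightarrow> nat list \<Rightarrow> nat list" where
  "osum \<sigma> \<tau> = \<sigma> @ map ((+) (length \<sigma>)) \<tau>"

lemma length_osum [simp]: "length (osum \<sigma> \<tau>) = length \<sigma> + length \<tau>"
  by (simp add: osum_def)

text \<open>Every value of the second block exceeds those of the first. If the 2 of a pattern lies
  in the second block, so does the larger and earlier 3, and with it everything between
  them.\<close>

lemma osum_in_av312:
  assumes \<sigma>: "\<sigma> \<in> av312 n" and \<tau>: "\<tau> \<in> av312 m"
  shows "osum \<sigma> \<tau> \<in> av312 (n + m)"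
proof -
  have "{1..n} \<union> (+) n ` {1..m} = {1..n + m}"
    using image_add_atLeastAtMost[of n 1 m] by auto
  then have perm: "osum \<sigma> \<tau> \<in> perms (n + m)"
    using \<sigma> \<tau> length_av312[OF \<sigma>]
    by (auto simp: av312_def perms_def osum_def distinct_map)
  have "\<not> has312 (osum \<sigma> \<tau>)"
  proof
    assume "has312 (osum \<sigma> \<tau>)"
    then obtain i j l where *: "i < j" "j < l" "l < n + m" "osum \<sigma> \<tau> ! j < osum \<sigma> \<tau> ! l"
      "osum \<sigma> \<tau> ! l < osum \<sigma> \<tau> ! i"
      using \<sigma> \<tau> by (auto simp: has312_def length_av312)
    have hi: "osum \<sigma> \<tau> ! p = n + \<tau> ! (p - n)" if "n \<le> p" "p < n + m" for p
      using that \<sigma> \<tau> by (simp add: osum_def nth_append length_av312)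
    have lo: "osum \<sigma> \<tau> ! p = \<sigma> ! p" if "p < n" for p
      using that \<sigma> \<tau> by (simp add: osum_def nth_append length_av312)
    show False
    proof (cases "l < n")
      case True
      then have "has312 \<sigma>" unfolding has312_def
        using * lo length_av312[OF \<sigma>] by (intro exI[of _ i] exI[of _ j] exI[of _ l]) simp
      then show False using \<sigma> by (simp add: av312_def)
    next
      case False
      have "n \<le> i"
      proof (rule ccontr)
        assume i: "\<not> n \<le> i"
        then have "osum \<sigma> \<tau> ! i \<le> n"
          using lo[of i] nth_mem[of i \<sigma>] length_av312[OF \<sigma>] set_av312[OF \<sigma>] by simp
        then show False using * hi[of l] False by simp
      qed
      then have "i - n < j - n" "j - n < l - n" "l - n < length \<tau>"
        "\<tau> ! (j - n) < \<tau> ! (l - n)" "\<tau> ! (l - n) < \<tau> ! (i - n)"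
        using * hi[of i] hi[of j] hi[of l] length_av312[OF \<tau>] by simp_all
      then have "has312 \<tau>" unfolding has312_def by blast
      then show False using \<tau> by (simp add: av312_def)
    qed
  qed
  then show ?thesis using perm by (simp add: av312_def)
qed

lemma win_osum1: "i + k \<le> length \<sigma> \<Longrightarrow> win k (osum \<sigma> \<tau>) i = win k \<sigma> i"
  by (simp add: osum_def win_append1)

lemma win_osum2: "win k (osum \<sigma> \<tau>) (length \<sigma> + i) = win k \<tau> i"
proof -
  have "win k (osum \<sigma> \<tau>) (length \<sigma> + i) = win k (map ((+) (length \<sigma>)) \<tau>) i"
    by (simp add: osum_def win_def)
  then show ?thesis by (simp add: win_map_strict_mono strict_mono_on_def)
qed

text \<open>Only windows straddling the seam are miscounted. They start in
  \<open>{n + 1 - k..<n}\<close>, which has at most \<open>k - 1\<close> elements.\<close>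

lemma c_occ_osum:
  assumes \<pi>: "\<pi> \<in> perms k" and "k \<ge> 1"
  shows "\<bar>real (c_occ \<pi> (osum \<sigma> \<tau>)) - (real (c_occ \<pi> \<sigma>) + real (c_occ \<pi> \<tau>))\<bar> \<le> real k"
proof -
  define n where "n = length \<sigma>"
  define S where "S = {i. i + k \<le> length (osum \<sigma> \<tau>) \<and> win k (osum \<sigma> \<tau>) i = \<pi>}"
  define S1 where "S1 = {i. i + k \<le> n \<and> win k \<sigma> i = \<pi>}"
  define S2 where "S2 = {i. i + k \<le> length \<tau> \<and> win k \<tau> i = \<pi>}"
  have fin: "finite S" "finite S1" "finite S2"
    by (rule finite_subset[of _ "{..length (osum \<sigma> \<tau>)}"]; auto simp: S_def S1_def S2_def n_def)+
  have "S1 \<union> (+) n ` S2 \<subseteq> S"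
    by (auto simp: S_def S1_def S2_def n_def win_osum1 win_osum2)
  then have 1: "card (S1 \<union> (+) n ` S2) \<le> card S" using fin by (intro card_mono)
  have "S \<subseteq> (S1 \<union> (+) n ` S2) \<union> {n + 1 - k..<n}"
  proof
    fix i assume i: "i \<in> S"
    consider "i + k \<le> n" | "n \<le> i" | "n + 1 - k \<le> i" "i < n" by linarith
    then show "i \<in> (S1 \<union> (+) n ` S2) \<union> {n + 1 - k..<n}"
    proof cases
      case 1
      then show ?thesis using i by (simp add: S_def S1_def n_def win_osum1)
    next
      case 2
      then have "i - n \<in> S2" using i win_osum2[of k \<sigma> \<tau> "i - n"] by (auto simp: S_def S2_def n_def)
      then show ?thesis using 2 by force
    qed simp
  qed
  then have "card S \<le> card ((S1 \<union> (+) n ` S2) \<union> {n + 1 - k..<n})" using fin by (intro card_mono) auto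
  also have "\<dots> \<le> card (S1 \<union> (+) n ` S2) + card {n + 1 - k..<n}" by (rule card_Un_le)
  also have "card {n + 1 - k..<n} \<le> k" by simp
  finally have 2: "card S \<le> card (S1 \<union> (+) n ` S2) + k" by simp
  have "S1 \<inter> (+) n ` S2 = {}" using \<open>k \<ge> 1\<close> by (auto simp: S1_def)
  then have "card (S1 \<union> (+) n ` S2) = card S1 + card S2"
    using fin by (simp add: card_Un_disjoint card_image)
  moreover have "c_occ \<pi> (osum \<sigma> \<tau>) = card S" "c_occ \<pi> \<sigma> = card S1" "c_occ \<pi> \<tau> = card S2"
    by (simp_all only: c_occ_eq[OF \<pi>] S_def S1_def S2_def n_def)
  ultimately show ?thesis using 1 2 by simp
qed

subsection \<open>Counting 312-avoiding permutations\<close>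

text \<open>Active sites of the generating tree of 312-avoiding permutations: the values that may be
  appended. Appending at the \<open>j\<close>-th active site produces a node with \<open>j + 1\<close> active sites.\<close>
definition sites :: "nat list \<Rightarrow> nat set" where
  "sites \<sigma> = {x \<in> {1..Suc (length \<sigma>)}. \<not> crossed \<sigma> x}"

text \<open>Removing the last entry and closing the gap in the values is the inverse. Avoidance is
  inherited by the shortened permutation, and the removed value is a site because it was not
  crossed.\<close>

lemma bij_betw_ins:
  "bij_betw (\<lambda>(\<sigma>, x). ins x \<sigma>) (SIGMA \<sigma>:av312 n. sites \<sigma>) (av312 (Suc n))"
  unfolding bij_betw_def
proof
  show "inj_on (\<lambda>(\<sigma>, x). ins x \<sigma>) (SIGMA \<sigma>:av312 n. sites \<sigma>)"
    using inj_bump by (auto simp: inj_on_def ins_def dest!: map_injective)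
  show "(\<lambda>(\<sigma>, x). ins x \<sigma>) ` (SIGMA \<sigma>:av312 n. sites \<sigma>) = av312 (Suc n)"
  proof (intro equalityI subsetI)
    fix \<tau> assume "\<tau> \<in> (\<lambda>(\<sigma>, x). ins x \<sigma>) ` (SIGMA \<sigma>:av312 n. sites \<sigma>)"
    then obtain \<sigma> x where *: "\<sigma> \<in> av312 n" "x \<in> sites \<sigma>" "\<tau> = ins x \<sigma>" by auto
    then show "\<tau> \<in> av312 (Suc n)" using length_av312[OF *(1)]
      by (auto simp: av312_def sites_def has312_ins intro: ins_in_perms)
  next
    fix \<tau> assume \<tau>: "\<tau> \<in> av312 (Suc n)"
    then have "\<tau> \<noteq> []" using length_av312 by fastforce
    then obtain b x where bx: "\<tau> = b @ [x]" by (metis rev_exhaust)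
    \<comment> \<open>\<open>u\<close> undoes \<open>bump x\<close> on values different from
      \<open>x\<close>.\<close>
    define u where "u y = (if x < y then y - 1 else y)" for y
    define \<sigma> where "\<sigma> = map u b"
    have d: "distinct b" "x \<notin> set b" and s: "insert x (set b) = {1..Suc n}"
      using distinct_av312[OF \<tau>] set_av312[OF \<tau>] by (auto simp: bx)
    have "bump x (u y) = y" if "y \<in> set b" for y
      using that d by (auto simp: bump_def u_def)
    then have "map (bump x) \<sigma> = b" by (simp add: \<sigma>_def map_idI)
    then have ins: "ins x \<sigma> = \<tau>" by (simp add: ins_def bx)
    have x: "x \<in> {1..Suc n}" using s by auto
    have len: "length \<sigma> = n" using length_av312[OF \<tau>] by (simp add: \<sigma>_def bx)
    have "distinct \<sigma>" using \<open>map (bump x) \<sigma> = b\<close> d(1) distinct_map by blast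
    moreover have "set \<sigma> \<subseteq> {1..n}"
    proof
      fix z assume "z \<in> set \<sigma>"
      then obtain y where y: "y \<in> set b" "z = u y" by (auto simp: \<sigma>_def)
      then have "y \<in> {1..Suc n}" "y \<noteq> x" using s d by auto
      then show "z \<in> {1..n}" using y x by (auto simp: u_def)
    qed
    moreover have "card (set \<sigma>) = card {1..n}" using distinct_card[OF \<open>distinct \<sigma>\<close>] len by simp
    ultimately have "\<sigma> \<in> perms n" using card_subset_eq[of "{1..n}" "set \<sigma>"] by (simp add: perms_def)
    then have "\<sigma> \<in> av312 n" "x \<in> sites \<sigma>"
      using \<tau> x len by (auto simp: av312_def sites_def has312_ins simp flip: ins)
    then show "\<tau> \<in> (\<lambda>(\<sigma>, x). ins x \<sigma>) ` (SIGMA \<sigma>:av312 n. sites \<sigma>)" using ins by force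
  qed
qed

lemma crossed_snoc:
  "crossed (xs @ [x]) y \<longleftrightarrow> crossed xs y \<or> (x < y \<and> (\<exists>i<length xs. y \<le> xs ! i))"
  unfolding crossed_def
proof (intro iffI; elim disjE exE conjE)
  fix i j
  assume "i < j" "j < length (xs @ [x])" "(xs @ [x]) ! j < y" "y \<le> (xs @ [x]) ! i"
  then show "(\<exists>i j. i < j \<and> j < length xs \<and> xs ! j < y \<and> y \<le> xs ! i) \<or>
    (x < y \<and> (\<exists>i<length xs. y \<le> xs ! i))"
    by (cases "j < length xs") (auto simp: nth_append less_Suc_eq; blast)+
next
  fix i j
  assume "i < j" "j < length xs" "xs ! j < y" "y \<le> xs ! i"
  then show "\<exists>i j. i < j \<and> j < length (xs @ [x]) \<and> (xs @ [x]) ! j < y \<and> y \<le> (xs @ [x]) ! i"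
    by (intro exI[of _ i] exI[of _ j]) (simp add: nth_append)
next
  fix i
  assume "i < length xs" "x < y" "y \<le> xs ! i"
  then show "\<exists>i j. i < j \<and> j < length (xs @ [x]) \<and> (xs @ [x]) ! j < y \<and> y \<le> (xs @ [x]) ! i"
    by (intro exI[of _ i] exI[of _ "length xs"]) (simp add: nth_append)
qed

text \<open>Sites up to \<open>x\<close> keep their status, since the new entry is not below them. A
  value \<open>y\<close> with \<open>x < y \<le> Suc n\<close> gets crossed by the old maximum, now
  \<open>Suc n\<close>, followed by the new entry \<open>x\<close>. The new top value lies above all
  entries.\<close>

lemma sites_ins:
  assumes \<sigma>: "\<sigma> \<in> av312 n" and x: "x \<in> sites \<sigma>"
  shows "sites (ins x \<sigma>) = insert (Suc (Suc n)) {y \<in> sites \<sigma>. y \<le> x}"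
proof -
  note len = length_av312[OF \<sigma>]
  have xn: "1 \<le> x" "x \<le> Suc n" using x len by (auto simp: sites_def)
  have b: "crossed (ins x \<sigma>) y \<longleftrightarrow> crossed \<sigma> y" if "y \<le> x" for y
  proof -
    have "bump x z < y \<longleftrightarrow> z < y" "y \<le> bump x z \<longleftrightarrow> y \<le> z" for z
      using that by (auto simp: bump_def)
    then have "crossed (map (bump x) \<sigma>) y \<longleftrightarrow> crossed \<sigma> y"
      unfolding crossed_def by (auto cong: conj_cong)
    then show ?thesis using that by (simp add: ins_def crossed_snoc)
  qed
  have m: "crossed (ins x \<sigma>) y" if "x < y" "y \<le> Suc n" for y
  proof -
    have "n \<in> set \<sigma>" using set_av312[OF \<sigma>] xn that by simp
    then obtain i where i: "i < n" "\<sigma> ! i = n" using len by (auto simp: in_set_conv_nth)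
    then have "y \<le> map (bump x) \<sigma> ! i" using that len by (simp add: bump_def)
    then show ?thesis using that i len by (auto simp: ins_def crossed_snoc)
  qed
  have t: "\<not> crossed (ins x \<sigma>) (Suc (Suc n))"
  proof -
    have z: "z \<le> Suc n" if "z \<in> set (ins x \<sigma>)" for z
      using that xn set_av312[OF \<sigma>] by (auto simp: ins_def bump_def)
    have "\<not> Suc (Suc n) \<le> ins x \<sigma> ! i" if "i < length (ins x \<sigma>)" for i
      using z[OF nth_mem[OF that]] by simp
    then show ?thesis unfolding crossed_def by (meson less_trans)
  qed
  show ?thesis
  proof (intro set_eqI iffI)
    fix y assume y: "y \<in> sites (ins x \<sigma>)"
    then have "y \<le> x \<or> y = Suc (Suc n)" using m[of y] len by (fastforce simp: sites_def)
    then show "y \<in> insert (Suc (Suc n)) {y \<in> sites \<sigma>. y \<le> x}"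
      using y b xn len by (auto simp: sites_def)
  next
    fix y assume y: "y \<in> insert (Suc (Suc n)) {y \<in> sites \<sigma>. y \<le> x}"
    then show "y \<in> sites (ins x \<sigma>)" using t b len by (auto simp: sites_def)
  qed
qed

text \<open>Ranks run through \<open>1..card A\<close> once each; a new maximum leaves the other
  ranks unchanged. This turns a sum over sites into a sum over their number.\<close>

lemma sum_over_ranks:
  fixes A :: "nat set" and f :: "nat \<Rightarrow> nat"
  assumes "finite A"
  shows "(\<Sum>x\<in>A. f (card {y \<in> A. y \<le> x})) = (\<Sum>j=1..card A. f j)"
  using assms
proof (induction A rule: finite_linorder_max_induct)
  case empty
  then show ?case by simp
next
  case (insert b A)
  have b: "b \<notin> A" using insert by auto
  have "{y \<in> insert b A. y \<le> x} = {y \<in> A. y \<le> x}" if "x \<in> A" for x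
    using insert that by fastforce
  then have "(\<Sum>x\<in>A. f (card {y \<in> insert b A. y \<le> x})) = (\<Sum>j=1..card A. f j)"
    using insert.IH by simp
  moreover have "{y \<in> insert b A. y \<le> b} = insert b A" using insert by fastforce
  ultimately show ?case using insert b by (simp add: add.commute)
qed

section \<open>Ballot numbers and Catalan numbers\<close>

text \<open>\<open>ballot m a\<close> counts the descendants, \<open>m\<close> generations down, of
  a node with \<open>a\<close> sites, whose children have 2, ..., \<open>a + 1\<close>
  sites.\<close>

primrec ballot :: "nat \<Rightarrow> nat \<Rightarrow> nat" where
  "ballot 0 a = 1"
| "ballot (Suc m) a = (\<Sum>j=2..Suc a. ballot m j)"

text \<open>Descendants of the root \<open>[]\<close>, which has one site, are counted by way of
  generation \<open>n\<close>. Raising \<open>n\<close> by one costs one unit of \<open>m\<close>,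
  so \<open>m\<close> must be arbitrary in the induction. The case \<open>m = 0\<close> counts the
  permutations themselves.\<close>

lemma sum_ballot_sites:
  "(\<Sum>\<sigma>\<in>av312 n. ballot m (card (sites \<sigma>))) = ballot (n + m) 1"
proof (induction n arbitrary: m)
  case 0
  have "sites [] = {1}" by (auto simp: sites_def crossed_def)
  then show ?case by (simp add: av312_0)
next
  case (Suc n)
  have "(\<Sum>x\<in>sites \<sigma>. ballot m (card (sites (ins x \<sigma>)))) = ballot (Suc m) (card (sites \<sigma>))"
    if \<sigma>: "\<sigma> \<in> av312 n" for \<sigma>
  proof -
    have fin: "finite (sites \<sigma>)" by (simp add: sites_def)
    have "card (sites (ins x \<sigma>)) = Suc (card {y \<in> sites \<sigma>. y \<le> x})" if "x \<in> sites \<sigma>" for x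
    proof -
      have "Suc (Suc n) \<notin> {y \<in> sites \<sigma>. y \<le> x}" using length_av312[OF \<sigma>] by (auto simp: sites_def)
      then show ?thesis using fin by (simp add: sites_ins[OF \<sigma> that])
    qed
    then have "(\<Sum>x\<in>sites \<sigma>. ballot m (card (sites (ins x \<sigma>)))) =
        (\<Sum>x\<in>sites \<sigma>. ballot m (Suc (card {y \<in> sites \<sigma>. y \<le> x})))" by simp
    also have "\<dots> = (\<Sum>j=1..card (sites \<sigma>). ballot m (Suc j))"
      using sum_over_ranks[OF fin] .
    also have "\<dots> = (\<Sum>j=Suc 1..Suc (card (sites \<sigma>)). ballot m j)"
      by (rule sum.shift_bounds_cl_Suc_ivl[symmetric])
    finally show ?thesis by (simp add: numeral_2_eq_2)
  qed
  then have "(\<Sum>\<sigma>\<in>av312 n. \<Sum>x\<in>sites \<sigma>. ballot m (card (sites (ins x \<sigma>)))) = ballot (n + Suc m) 1"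
    using Suc.IH[of "Suc m"] by simp
  moreover have "(\<Sum>\<tau>\<in>av312 (Suc n). ballot m (card (sites \<tau>))) =
      (\<Sum>(\<sigma>, x)\<in>(SIGMA \<sigma>:av312 n. sites \<sigma>). ballot m (card (sites (ins x \<sigma>))))"
    by (subst sum.reindex_bij_betw[OF bij_betw_ins, symmetric]) (simp add: case_prod_unfold)
  moreover have "\<dots> = (\<Sum>\<sigma>\<in>av312 n. \<Sum>x\<in>sites \<sigma>. ballot m (card (sites (ins x \<sigma>))))"
    by (subst sum.Sigma) (auto simp: finite_av312 sites_def)
  ultimately show ?case by simp
qed

text \<open>The reflection-principle difference of neighbouring binomials, written additively to
  stay in the naturals. The inner induction on \<open>a\<close> is Pascal's rule; it starts at
  \<open>a = 0\<close>, where the ballot number is an empty sum and the two binomials agree by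
  symmetry.\<close>

lemma ballot_closed_form:
  "ballot (Suc m) a + ((2 * m + a + 1) choose m) = ((2 * m + a + 1) choose Suc m)"
proof (induction m arbitrary: a)
  case 0
  show ?case by simp
next
  case (Suc m)
  show ?case
  proof (induction a)
    case 0
    have "(2 * Suc m + 0 + 1) choose Suc m = (2 * Suc m + 0 + 1) choose Suc (Suc m)"
      by (subst binomial_symmetric) auto
    then show ?case by simp
  next
    case (Suc a)
    have "ballot (Suc (Suc m)) (Suc a) = ballot (Suc (Suc m)) a + ballot (Suc m) (a + 2)"
      by simp
    moreover have "ballot (Suc m) (a + 2) + ((2 * m + a + 3) choose m) = (2 * m + a + 3) choose Suc m"
      using Suc.IH \<open>\<And>a. ballot (Suc m) a + ((2 * m + a + 1) choose m) = ((2 * m + a + 1) choose Suc m)\<close>[of "a + 2"]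
      by (simp add: eval_nat_numeral)
    moreover have "2 * Suc m + a + 1 = 2 * m + a + 3" "2 * Suc m + Suc a + 1 = Suc (2 * m + a + 3)" by simp_all
    ultimately show ?case using Suc.IH by (simp only: binomial_Suc_Suc)
  qed
qed

lemma card_av312: "card (av312 n) = catalan n"
proof -
  have c: "card (av312 n) = ballot n 1" using sum_ballot_sites[of 0 n] by simp
  show ?thesis
  proof (cases n)
    case 0
    then show ?thesis by (simp add: catalan_def av312_0)
  next
    case (Suc m)
    let ?N = "2 * Suc m"
    have b: "ballot (Suc m) 1 + (?N choose m) = ?N choose Suc m"
      using ballot_closed_form[of m 1] by simp
    \<comment> \<open>The ratio of the two neighbouring binomials turns their difference into the
      quotient that defines \<open>catalan\<close>.\<close>
    have "Suc m * (?N choose Suc m) = (?N - m) * (?N choose m)"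
      by (metis binomial_absorb_comp binomial_absorption)
    then have "Suc m * (?N choose Suc m) = (Suc m + 1) * (?N choose m)" by simp
    moreover have "(Suc m + 1) * ballot (Suc m) 1 + (Suc m + 1) * (?N choose m) = (Suc m + 1) * (?N choose Suc m)"
      by (metis b distrib_left)
    ultimately have "(Suc m + 1) * ballot (Suc m) 1 = ?N choose Suc m" by simp
    then have "(?N choose Suc m) div (Suc m + 1) = ballot (Suc m) 1"
      by (metis nonzero_mult_div_cancel_left add_is_0 one_neq_zero)
    then show ?thesis using c Suc by (simp add: catalan_def)
  qed
qed

subsection \<open>Circulations and simple cycles\<close>

definition divergence :: "'e set \<Rightarrow> ('e \<Rightarrow> 'v) \<Rightarrow> ('e \<Rightarrow> 'v) \<Rightarrow> ('e \<Rightarrow> real) \<Rightarrow> 'v \<Rightarrow> real" where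
  "divergence E s t v u = (\<Sum>e\<in>{e\<in>E. s e = u}. v e) - (\<Sum>e\<in>{e\<in>E. t e = u}. v e)"

definition circulations :: "'e set \<Rightarrow> ('e \<Rightarrow> 'v) \<Rightarrow> ('e \<Rightarrow> 'v) \<Rightarrow> ('e \<Rightarrow> real) set" where
  "circulations E s t =
    {v. (\<forall>e. e \<notin> E \<longrightarrow> v e = 0) \<and> (\<forall>e. 0 \<le> v e) \<and> (\<forall>u. divergence E s t v u = 0)}"

definition unit_circulations :: "'e set \<Rightarrow> ('e \<Rightarrow> 'v) \<Rightarrow> ('e \<Rightarrow> 'v) \<Rightarrow> ('e \<Rightarrow> real) set" where
  "unit_circulations E s t = {v \<in> circulations E s t. sum v E = 1}"

text \<open>Cyclic composability as one equation of lists: targets are the sources rotated by one,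
  so every vertex is entered as often as it is left.\<close>

definition graph_cycle :: "'e set \<Rightarrow> ('e \<Rightarrow> 'v) \<Rightarrow> ('e \<Rightarrow> 'v) \<Rightarrow> 'e list \<Rightarrow> bool" where
  "graph_cycle E s t cs \<longleftrightarrow>
    cs \<noteq> [] \<and> set cs \<subseteq> E \<and> map t cs = rotate1 (map s cs) \<and> distinct (map s cs)"

lemma scaleR_fun_apply [simp]: "(r *\<^sub>R f) x = r *\<^sub>R f x"
  by (simp add: scaleR_fun_def)

lemma divergence_add: "divergence E s t (v + w) u = divergence E s t v u + divergence E s t w u"
  by (simp add: divergence_def sum.distrib)

lemma divergence_scaleR: "divergence E s t (c *\<^sub>R v) u = c * divergence E s t v u"
  by (simp add: divergence_def sum_distrib_left algebra_simps)

lemma divergence_diff: "divergence E s t (v - w) u = divergence E s t v u - divergence E s t w u"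
  by (simp add: divergence_def sum_subtractf)

lemma divergence_cong:
  "(\<And>e. e \<in> E \<Longrightarrow> v e = w e) \<Longrightarrow> divergence E s t v u = divergence E s t w u"
  unfolding divergence_def by (intro arg_cong2[where f = "(-)"] sum.cong) auto

lemma divergence_sum:
  assumes "finite I"
  shows "divergence E s t (\<lambda>e. \<Sum>i\<in>I. v i e) u = (\<Sum>i\<in>I. divergence E s t (v i) u)"
  using assms
proof (induction I rule: finite_induct)
  case (insert i I)
  have "(\<lambda>e. \<Sum>j\<in>insert i I. v j e) = v i + (\<lambda>e. \<Sum>j\<in>I. v j e)"
    using insert by (auto simp: fun_eq_iff)
  then show ?case using insert by (simp add: divergence_add)
qed (simp add: divergence_def)

lemma linear_divergence: "linear (\<lambda>v. divergence E s t v u)"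
  by (rule linearI) (simp_all add: divergence_add divergence_scaleR)

text \<open>Each edge contributes once with either sign.\<close>

lemma sum_divergence:
  assumes "finite E" "finite V" "s ` E \<subseteq> V" "t ` E \<subseteq> V"
  shows "(\<Sum>u\<in>V. divergence E s t v u) = 0"
  unfolding divergence_def sum_subtractf using assms by (simp add: sum.group)

lemma convex_unit_circulations: "convex (unit_circulations E s t)"
proof (rule convexI)
  fix v w :: "'a \<Rightarrow> real" and a b :: real
  assume *: "v \<in> unit_circulations E s t" "w \<in> unit_circulations E s t" "0 \<le> a" "0 \<le> b" "a + b = 1"
  have "sum (a *\<^sub>R v + b *\<^sub>R w) E = a * sum v E + b * sum w E"
    by (simp add: sum.distrib sum_distrib_left)
  then show "a *\<^sub>R v + b *\<^sub>R w \<in> unit_circulations E s t"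
    using * by (simp add: unit_circulations_def circulations_def divergence_add divergence_scaleR)
qed

lemma count_list_distinct: "distinct xs \<Longrightarrow> count_list xs x = (if x \<in> set xs then 1 else 0)"
  by (induction xs) auto

lemma cycle_vec_distinct:
  "distinct cs \<Longrightarrow> cycle_vec cs e = (if e \<in> set cs then 1 / real (length cs) else 0)"
  by (simp add: cycle_vec_def count_list_distinct)

lemma sum_count_list_fibre:
  assumes "finite E" "set cs \<subseteq> E"
  shows "(\<Sum>e\<in>{e\<in>E. f e = u}. count_list cs e) = count_list (map f cs) u"
  using assms(2)
proof (induction cs)
  case (Cons c cs)
  have "(\<Sum>e\<in>{e\<in>E. f e = u}. count_list (c # cs) e) =
      (\<Sum>e\<in>{e\<in>E. f e = u}. (if e = c then 1 else 0) + count_list cs e)"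
    by (intro sum.cong) auto
  then show ?case using Cons assms(1) by (simp add: sum.distrib)
qed simp

lemma count_list_rotate1: "count_list (rotate1 xs) x = count_list xs x"
  by (cases xs) auto

lemma graph_cycle_distinct: "graph_cycle E s t cs \<Longrightarrow> distinct cs"
  by (simp add: graph_cycle_def distinct_map)

lemma cycle_vec_in_unit_circulations:
  assumes "finite E" "graph_cycle E s t cs"
  shows "cycle_vec cs \<in> unit_circulations E s t"
proof -
  have cs: "cs \<noteq> []" "set cs \<subseteq> E" "map t cs = rotate1 (map s cs)"
    using assms(2) by (auto simp: graph_cycle_def)
  have "divergence E s t (cycle_vec cs) u = 0" for u
  proof -
    have *: "(\<Sum>e\<in>{e\<in>E. f e = u}. cycle_vec cs e) = count_list (map f cs) u / length cs" for f
      by (simp add: cycle_vec_def sum_divide_distrib[symmetric] sum_count_list_fibre[OF assms(1) cs(2), symmetric])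
    show ?thesis unfolding divergence_def * by (simp add: cs(3) count_list_rotate1)
  qed
  moreover have "sum (cycle_vec cs) E = 1"
  proof -
    have "sum (count_list cs) E = length cs"
      using sum_count_set[OF cs(2) assms(1)] .
    then show ?thesis
      using cs(1) by (simp add: cycle_vec_def sum_divide_distrib[symmetric] flip: of_nat_sum)
  qed
  moreover have "cycle_vec cs e = 0" if "e \<notin> E" for e
    using that cs(2) by (auto simp: cycle_vec_def count_list_0_iff)
  ultimately show ?thesis
    by (simp add: unit_circulations_def circulations_def cycle_vec_def)
qed

text \<open>By conservation an edge of positive weight is followed by another one. Iterating this
  choice in a finite graph must repeat a source.\<close>

lemma circulation_support_cycle:
  assumes "finite E" and v: "v \<in> circulations E s t" and e0: "e0 \<in> E" "v e0 > 0"
  shows "\<exists>cs. graph_cycle {e\<in>E. v e > 0} s t cs"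
proof -
  have "\<exists>e'\<in>E. v e' > 0 \<and> s e' = t e" if e: "e \<in> E" "v e > 0" for e
  proof (rule ccontr)
    assume no: "\<not> (\<exists>e'\<in>E. v e' > 0 \<and> s e' = t e)"
    have nn: "v e' \<ge> 0" for e' using v by (simp add: circulations_def)
    have "v e \<le> (\<Sum>e'\<in>{e'\<in>E. t e' = t e}. v e')"
      using assms(1) e nn by (intro member_le_sum) auto
    moreover have "(\<Sum>e'\<in>{e'\<in>E. s e' = t e}. v e') = 0"
      using no nn by (intro sum.neutral) (auto simp: order_less_le)
    moreover have "divergence E s t v (t e) = 0" using v by (simp add: circulations_def)
    ultimately show False using e by (simp add: divergence_def)
  qed
  then obtain nx where nx: "\<And>e. e \<in> E \<Longrightarrow> v e > 0 \<Longrightarrow> nx e \<in> E \<and> v (nx e) > 0 \<and> s (nx e) = t e"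
    by metis
  define f where "f i = (nx ^^ i) e0" for i
  have f: "f i \<in> E \<and> v (f i) > 0" for i
    by (induction i) (use e0 nx in \<open>auto simp: f_def\<close>)
  have step: "t (f i) = s (f (Suc i))" for i
    using nx[of "f i"] f[of i] by (simp add: f_def)
  have "\<not> inj (\<lambda>i. s (f i))"
  proof
    assume "inj (\<lambda>i. s (f i))"
    moreover have "range (\<lambda>i. s (f i)) \<subseteq> s ` E" using f by auto
    ultimately show False
      using assms(1) by (meson finite_imageI finite_subset finite_imageD infinite_UNIV_nat)
  qed
  then have ex: "\<exists>j. \<exists>i<j. s (f i) = s (f j)"
    unfolding inj_def by (metis linorder_neqE_nat)
  \<comment> \<open>With \<open>j\<close> the earliest repetition, the sources before
    \<open>j\<close> are pairwise distinct, and the segment from \<open>i\<close> to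
    \<open>j\<close> closes up.\<close>
  define j where "j = (LEAST j. \<exists>i<j. s (f i) = s (f j))"
  obtain i where i: "i < j" "s (f i) = s (f j)"
    using LeastI_ex[OF ex] unfolding j_def by blast
  have min: "s (f a) \<noteq> s (f b)" if "a < b" "b < j" for a b
    using not_less_Least[of b "\<lambda>j. \<exists>i<j. s (f i) = s (f j)"] that unfolding j_def by blast
  define cs where "cs = map f [i..<j]"
  have "distinct (map s cs)"
  proof -
    have "inj_on (\<lambda>a. s (f a)) {i..<j}"
      by (rule inj_onI) (metis min atLeastLessThan_iff linorder_neqE_nat)
    then show ?thesis by (simp add: cs_def distinct_map comp_def)
  qed
  moreover have "map t cs = rotate1 (map s cs)"
  proof (rule nth_equalityI)
    have nth: "map s cs ! b = s (f (i + b))" if "b < j - i" for b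
      using that by (simp add: cs_def)
    fix a assume "a < length (map t cs)"
    then have a: "a < j - i" by (simp add: cs_def)
    then have "rotate1 (map s cs) ! a = map s cs ! (Suc a mod (j - i))"
      by (subst nth_rotate1) (simp_all add: cs_def)
    also have "\<dots> = s (f (Suc (i + a)))"
    proof (cases "Suc a = j - i")
      case True
      then have "j = Suc (i + a)" by simp
      then show ?thesis using True i nth[of 0] by simp
    next
      case False
      then show ?thesis using a nth[of "Suc a"] by simp
    qed
    finally show "map t cs ! a = rotate1 (map s cs) ! a"
      using a step by (simp add: cs_def)
  qed (simp add: cs_def)
  ultimately have "graph_cycle {e\<in>E. v e > 0} s t cs"
    using f i by (auto simp: graph_cycle_def cs_def)
  then show ?thesis by blast
qed

text \<open>Subtract the largest multiple of a cycle in the support that keeps all weights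
  nonnegative: some edge drops to 0, so the support shrinks. The remainder no longer has mass 1,
  hence the normalisation in the statement.\<close>

lemma circulation_in_convex_hull_cycles:
  assumes "finite E" "v \<in> circulations E s t" "sum v E > 0"
  shows "(1 / sum v E) *\<^sub>R v \<in> convex hull {cycle_vec cs |cs. graph_cycle E s t cs}" (is "_ \<in> ?H")
  using assms(2,3)
proof (induction "card {e\<in>E. v e > 0}" arbitrary: v rule: less_induct)
  case less
  have nn: "v e \<ge> 0" and out: "e \<notin> E \<Longrightarrow> v e = 0" for e
    using less.prems by (auto simp: circulations_def)
  obtain e0 where "e0 \<in> E" "v e0 > 0"
    using less.prems(2) nn by (metis order_less_le sum_nonpos not_le)
  then obtain cs where cs': "graph_cycle {e\<in>E. v e > 0} s t cs"
    using circulation_support_cycle[OF assms(1) less.prems(1)] by blast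
  then have cs: "graph_cycle E s t cs" and pos: "\<And>e. e \<in> set cs \<Longrightarrow> v e > 0"
    and ne: "cs \<noteq> []" and sub: "set cs \<subseteq> E"
    by (auto simp: graph_cycle_def)
  have inH: "cycle_vec cs \<in> ?H" using cs by (intro hull_inc) blast
  note cv = cycle_vec_in_unit_circulations[OF assms(1) cs]
  define m where "m = Min (v ` set cs)"
  have "m \<in> v ` set cs" unfolding m_def using ne by (intro Min_in) auto
  then obtain e1 where e1: "e1 \<in> set cs" "v e1 = m" by auto
  have le: "m \<le> v e" if "e \<in> set cs" for e unfolding m_def using that by (intro Min_le) auto
  \<comment> \<open>\<open>cycle_vec cs\<close> is \<open>1 / length cs\<close> on each edge of the
    cycle, so \<open>c\<close> times it removes exactly \<open>m\<close> from each.\<close>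
  define c where "c = m * length cs"
  have c: "c > 0" using pos[OF e1(1)] e1 ne by (simp add: c_def)
  define w where "w = v - c *\<^sub>R cycle_vec cs"
  have w: "w e = v e - (if e \<in> set cs then m else 0)" for e
    using ne by (simp add: w_def c_def cycle_vec_distinct[OF graph_cycle_distinct[OF cs]])
  have wc: "w \<in> circulations E s t"
    using less.prems(1) cv nn le out sub
    by (auto simp: circulations_def unit_circulations_def w_def divergence_diff divergence_scaleR)
       (auto simp: w[unfolded w_def, simplified])
  have sw: "sum w E = sum v E - c"
    using cv by (simp add: w_def sum_subtractf unit_circulations_def flip: sum_distrib_left)
  have vw: "v = w + c *\<^sub>R cycle_vec cs" by (simp add: w_def)
  have wnn: "w e \<ge> 0" for e using wc by (simp add: circulations_def)
  show ?case
  proof (cases "sum w E > 0")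
    case True
    have "{e\<in>E. w e > 0} \<subset> {e\<in>E. v e > 0}"
    proof
      show "{e\<in>E. w e > 0} \<subseteq> {e\<in>E. v e > 0}"
        using pos by (auto simp: w split: if_splits)
      show "{e\<in>E. w e > 0} \<noteq> {e\<in>E. v e > 0}"
        using e1 pos[OF e1(1)] sub by (auto simp: w set_eq_iff)
    qed
    then have "card {e\<in>E. w e > 0} < card {e\<in>E. v e > 0}"
      using assms(1) by (intro psubset_card_mono) auto
    then have IH: "(1 / sum w E) *\<^sub>R w \<in> ?H" using less.hyps wc True by blast
    have "(1 / sum v E) *\<^sub>R v = (sum w E / sum v E) *\<^sub>R ((1 / sum w E) *\<^sub>R w) + (c / sum v E) *\<^sub>R cycle_vec cs"
      using True by (subst vw) (simp add: scaleR_add_right)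
    moreover have "\<dots> \<in> ?H"
      using True less.prems(2) c sw
      by (intro convexD[OF convex_convex_hull IH inH]) (auto simp: field_simps)
    ultimately show ?thesis by simp
  next
    case False
    have "sum w E = 0" using False wnn by (meson not_le order_antisym sum_nonneg)
    then have "w e = 0" for e
      using sum_nonneg_eq_0_iff[OF assms(1), of w] wnn wc by (cases "e \<in> E") (auto simp: circulations_def)
    then have "v = c *\<^sub>R cycle_vec cs" using vw by (auto simp: fun_eq_iff)
    moreover have "sum v E = c" using sw \<open>sum w E = 0\<close> by simp
    ultimately show ?thesis using inH c by simp
  qed
qed

lemma unit_circulations_eq_convex_hull:
  assumes "finite E"
  shows "unit_circulations E s t = convex hull {cycle_vec cs |cs. graph_cycle E s t cs}"
proof
  show "unit_circulations E s t \<subseteq> convex hull {cycle_vec cs |cs. graph_cycle E s t cs}"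
    using circulation_in_convex_hull_cycles[OF assms, of _ s t]
    by (force simp: unit_circulations_def)
  show "convex hull {cycle_vec cs |cs. graph_cycle E s t cs} \<subseteq> unit_circulations E s t"
    using cycle_vec_in_unit_circulations[OF assms]
    by (intro hull_minimal convex_unit_circulations) auto
qed

text \<open>At every vertex of the cycle just one supported edge enters and one leaves, so
  conservation makes the weight constant along the cycle; total mass 1 fixes the constant.\<close>

lemma unit_circulation_on_cycle_unique:
  assumes "finite E" and cs: "graph_cycle E s t cs" and w: "w \<in> unit_circulations E s t"
    and supp: "\<And>e. e \<notin> set cs \<Longrightarrow> w e = 0"
  shows "w = cycle_vec cs"
proof -
  define L where "L = length cs"
  have L: "L > 0" and sub: "set cs \<subseteq> E" and rot: "map t cs = rotate1 (map s cs)"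
    and ds: "distinct (map s cs)"
    using cs by (auto simp: graph_cycle_def L_def)
  have dt: "distinct (map t cs)" using ds rot by simp
  have single: "(\<Sum>e\<in>{e\<in>E. f e = f (cs ! i)}. w e) = w (cs ! i)"
    if "distinct (map f cs)" "i < L" for f :: "nat list \<Rightarrow> 'a" and i
  proof -
    have "cs ! i \<in> set cs" using that by (simp add: L_def)
    moreover have "e = cs ! i" if "e \<in> set cs" "f e = f (cs ! i)" for e
      using that \<open>distinct (map f cs)\<close> \<open>cs ! i \<in> set cs\<close> by (auto simp: distinct_map inj_on_def)
    ultimately have "(\<Sum>e\<in>{e\<in>E. f e = f (cs ! i)}. w e) = sum w {cs ! i}"
      using assms(1) sub supp by (intro sum.mono_neutral_right) auto
    then show ?thesis by simp
  qed
  have next_eq: "w (cs ! (Suc i mod L)) = w (cs ! i)" if "i < L" for i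
  proof -
    have "t (cs ! i) = map t cs ! i" using that by (simp add: L_def)
    also have "\<dots> = s (cs ! (Suc i mod L))" using that L
      unfolding rot by (subst nth_rotate1) (auto simp: L_def)
    finally have ts: "t (cs ! i) = s (cs ! (Suc i mod L))" .
    have "divergence E s t w (t (cs ! i)) = 0"
      using w by (simp add: unit_circulations_def circulations_def)
    then show ?thesis
      using single[OF dt that] single[OF ds, of "Suc i mod L"] L by (simp add: divergence_def ts)
  qed
  have const: "w (cs ! i) = w (cs ! 0)" if "i < L" for i
    using that
  proof (induction i)
    case (Suc i)
    then show ?case using next_eq[of i] by simp
  qed simp
  have d: "distinct cs" using graph_cycle_distinct[OF cs] .
  have all: "w e = w (cs ! 0)" if "e \<in> set cs" for e
    using that const by (auto simp: in_set_conv_nth L_def)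
  have "1 = sum w E" using w by (simp add: unit_circulations_def)
  also have "\<dots> = sum w (set cs)"
    using assms(1) sub supp by (intro sum.mono_neutral_right) auto
  also have "\<dots> = L * w (cs ! 0)" using all d by (simp add: distinct_card L_def)
  finally have "w (cs ! 0) = 1 / L" using L by (simp add: field_simps)
  then show ?thesis using all supp by (auto simp: fun_eq_iff cycle_vec_distinct[OF d] L_def)
qed

text \<open>Off the cycle a proper convex combination of two nonnegative values is 0, so both
  endpoints live on the cycle and coincide by uniqueness.\<close>

lemma cycle_vec_extreme_point:
  assumes "finite E" and cs: "graph_cycle E s t cs"
  shows "cycle_vec cs extreme_point_of unit_circulations E s t"
  unfolding extreme_point_of_def
proof (intro conjI ballI notI)
  show "cycle_vec cs \<in> unit_circulations E s t"
    by (rule cycle_vec_in_unit_circulations[OF assms])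
  fix a b assume a: "a \<in> unit_circulations E s t" and b: "b \<in> unit_circulations E s t"
    and "cycle_vec cs \<in> open_segment a b"
  then obtain u where u: "a \<noteq> b" "0 < u" "u < 1" "cycle_vec cs = (1 - u) *\<^sub>R a + u *\<^sub>R b"
    by (auto simp: in_segment)
  have "a e = 0 \<and> b e = 0" if "e \<notin> set cs" for e
  proof -
    have "0 = (1 - u) * a e + u * b e"
      using fun_cong[OF u(4), of e] that by (simp add: cycle_vec_distinct[OF graph_cycle_distinct[OF cs]])
    moreover have "a e \<ge> 0" "b e \<ge> 0" using a b by (auto simp: unit_circulations_def circulations_def)
    ultimately show ?thesis using u
      by (smt (verit, best) mult_nonneg_nonneg mult_pos_pos)
  qed
  then have "a = cycle_vec cs" "b = cycle_vec cs"
    using unit_circulation_on_cycle_unique[OF assms] a b by blast+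
  then show False using u(1) by simp
qed

subsection \<open>Dimension of the circulation polytope\<close>

text \<open>A basis of the kernel together with \<open>w\<close> is a basis of \<open>W\<close>. The
  ambient function space may have infinite dimension, so finiteness is carried by
  \<open>W \<subseteq> span F\<close>.\<close>

lemma dim_Int_kernel:
  fixes f :: "'a::real_vector \<Rightarrow> real"
  assumes W: "subspace W" "finite F" "W \<subseteq> span F" and f: "linear f" and w: "w \<in> W" "f w \<noteq> 0"
  shows "dim {x \<in> W. f x = 0} + 1 = dim W"
proof -
  let ?K = "{x \<in> W. f x = 0}"
  have K: "subspace ?K"
    using W(1) linear_add[OF f] linear_scale[OF f] linear_0[OF f] by (auto simp: subspace_def)
  obtain B where B: "B \<subseteq> ?K" "independent B" "?K \<subseteq> span B" "card B = dim ?K"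
    using basis_exists by blast
  have "finite B"
    using independent_span_bound[OF W(2) B(2)] B(1) W(3) by blast
  have spB: "span B = ?K" using B(1,3) K by (simp add: span_minimal subset_antisym)
  have "w \<notin> span B" using spB w by auto
  then have ind: "independent (insert w B)" using B(2) by (simp add: independent_insert)
  have "W \<subseteq> span (insert w B)"
  proof
    fix x assume x: "x \<in> W"
    have "x - (f x / f w) *\<^sub>R w \<in> ?K"
      using x w W(1) by (simp add: linear_diff[OF f] linear_scale[OF f] subspace_diff subspace_scale)
    then have "x - (f x / f w) *\<^sub>R w \<in> span B" using spB by simp
    then show "x \<in> span (insert w B)" by (rule span_breakdown_eq[THEN iffD2, OF exI])
  qed
  moreover have "insert w B \<subseteq> W" using B(1) w by auto
  ultimately have "dim W = card (insert w B)"
    using ind by (intro dim_unique[OF _ _ _ refl]) auto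
  also have "\<dots> = card B + 1"
    using \<open>finite B\<close> \<open>w \<notin> span B\<close> span_base by (subst card_insert_disjoint) auto
  finally show ?thesis using B(4) by simp
qed

text \<open>The dual vectors certify independence: \<open>w i\<close> lies in the kernel of all
  other functionals but not in that of \<open>f i\<close>, so each functional lowers the dimension
  by one.\<close>

lemma dim_common_kernel:
  fixes f :: "'i \<Rightarrow> 'a::real_vector \<Rightarrow> real"
  assumes W: "subspace W" "finite F" "W \<subseteq> span F" and "finite I"
    and f: "\<And>i. i \<in> I \<Longrightarrow> linear (f i)" and w: "\<And>i. i \<in> I \<Longrightarrow> w i \<in> W"
    and dual: "\<And>i j. i \<in> I \<Longrightarrow> j \<in> I \<Longrightarrow> f i (w j) = (if i = j then 1 else 0)"
  shows "dim {x \<in> W. \<forall>i\<in>I. f i x = 0} + card I = dim W"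
  using assms(4) f w dual
proof (induction I rule: finite_induct)
  case empty
  then show ?case by simp
next
  case (insert i I)
  let ?K = "{x \<in> W. \<forall>i\<in>I. f i x = 0}"
  have K: "subspace ?K"
    using W(1) linear_add[OF insert.prems(1)] linear_scale[OF insert.prems(1)]
      linear_0[OF insert.prems(1)] by (auto simp: subspace_def)
  have "w i \<in> ?K" "f i (w i) \<noteq> 0" using insert by auto
  then have "dim {x \<in> ?K. f i x = 0} + 1 = dim ?K"
    using K W(2,3) insert.prems(1) by (intro dim_Int_kernel[where F = F]) auto
  moreover have "{x \<in> ?K. f i x = 0} = {x \<in> W. \<forall>j\<in>insert i I. f j x = 0}" by auto
  moreover have "dim ?K + card I = dim W" using insert by auto
  ultimately show ?case using insert by simp
qed

definition supported_on :: "'e set \<Rightarrow> ('e \<Rightarrow> real) set" where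
  "supported_on E = {v. \<forall>e. e \<notin> E \<longrightarrow> v e = 0}"

lemma subspace_supported_on: "subspace (supported_on E)"
  by (auto simp: subspace_def supported_on_def scaleR_fun_def)

lemma supported_on_subset_span:
  assumes "finite E"
  shows "supported_on E \<subseteq> span ((\<lambda>e e'. if e' = e then 1 else 0) ` E)"
proof
  fix v :: "'a \<Rightarrow> real" assume v: "v \<in> supported_on E"
  have "v x = (\<Sum>e\<in>E. v e *\<^sub>R (\<lambda>e'. if e' = e then 1 else 0)) x" for x
  proof -
    have "(\<Sum>e\<in>F. v e *\<^sub>R (\<lambda>e'. if e' = e then 1 else 0)) x = (\<Sum>e\<in>F. if e = x then v x else 0)"
      if "finite F" for F
      using that by (induction F rule: finite_induct) (auto simp: scaleR_fun_def)
    from this[OF assms] show ?thesis using assms v by (auto simp: supported_on_def)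
  qed
  then have "v = (\<Sum>e\<in>E. v e *\<^sub>R (\<lambda>e'. if e' = e then 1 else 0))" by blast
  moreover have "\<dots> \<in> span ((\<lambda>e e'. if e' = e then 1 else 0) ` E)"
    by (intro span_sum span_scale span_base) auto
  ultimately show "v \<in> span ((\<lambda>e e'. if e' = e then 1 else 0) ` E)" by simp
qed

text \<open>The coordinate functionals are dual to the unit vectors and have common kernel
  0.\<close>

lemma dim_supported_on:
  assumes "finite E"
  shows "dim (supported_on E :: ('e \<Rightarrow> real) set) = card E"
proof -
  have "dim {x \<in> supported_on E. \<forall>i\<in>E. (\<lambda>v :: 'e \<Rightarrow> real. v i) x = 0} + card E = dim (supported_on E :: ('e \<Rightarrow> real) set)"
    by (rule dim_common_kernel[OF subspace_supported_on _ supported_on_subset_span[OF assms] assms,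
        where w = "\<lambda>e e'. if e' = e then 1 else 0"])
      (auto simp: assms supported_on_def intro!: linearI simp: scaleR_fun_def)
  moreover have "{x :: 'e \<Rightarrow> real. x \<in> supported_on E \<and> (\<forall>i\<in>E. x i = 0)} = {0}"
    by (auto simp: supported_on_def fun_eq_iff; metis)
  moreover have "dim {0 :: 'e \<Rightarrow> real} = 0"
    by (rule dim_unique[of "{}"]) (auto simp: independent_empty)
  ultimately show ?thesis by simp
qed

text \<open>\<open>p\<close> is a relative interior point: small moves from it along any solution of
  the homogeneous equations stay inside, so differences span the solution space \<open>K\<close>.
  The \<open>q u\<close> are unit flows from \<open>u\<close> to \<open>r\<close>; they show that
  the equations defining \<open>K\<close> are independent.\<close>

lemma affine_dim_unit_circulations:
  assumes fin: "finite E" "finite V" and st: "s ` E \<subseteq> V" "t ` E \<subseteq> V" and r: "r \<in> V"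
    and p: "p \<in> unit_circulations E s t" "\<And>e. e \<in> E \<Longrightarrow> p e > 0"
    and q: "\<And>u. u \<in> V - {r} \<Longrightarrow> q u \<in> supported_on E"
      "\<And>u x. u \<in> V - {r} \<Longrightarrow> divergence E s t (q u) x = of_bool (x = u) - of_bool (x = r)"
  shows "affine_dim (unit_circulations E s t) + card V = card E"
proof -
  let ?P = "unit_circulations E s t"
  define D where "D = {x - y |x y. x \<in> ?P \<and> y \<in> ?P}"
  \<comment> \<open>\<open>None\<close> is total mass and takes the place of the omitted vertex
    \<open>r\<close>, so there are \<open>card V\<close> functionals.\<close>
  define I where "I = insert None (Some ` (V - {r}))"
  define f where "f i = (\<lambda>v. case i of None \<Rightarrow> sum v E | Some u \<Rightarrow> divergence E s t v u)" for i
  \<comment> \<open>Subtracting a multiple of \<open>p\<close> removes the mass of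
    \<open>q u\<close> without changing its divergence, which makes the family dual to
    \<open>f\<close>.\<close>
  define w where "w i = (case i of None \<Rightarrow> p | Some u \<Rightarrow> q u - sum (q u) E *\<^sub>R p)" for i
  define K where "K = {x \<in> supported_on E. \<forall>i\<in>I. f i x = 0}"
  have pE: "sum p E = 1" "p \<in> supported_on E" "divergence E s t p u = 0" for u
    using p by (auto simp: unit_circulations_def circulations_def supported_on_def)
  have lin: "linear (f i)" for i
    by (cases i) (auto simp: f_def linear_divergence intro!: linearI simp: sum.distrib sum_distrib_left)
  have "finite I" using fin by (simp add: I_def)
  have "dim K + card I = dim (supported_on E :: ('a \<Rightarrow> real) set)"
    unfolding K_def
  proof (rule dim_common_kernel[OF subspace_supported_on _ supported_on_subset_span[OF fin(1)] \<open>finite I\<close>])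
    show "w i \<in> supported_on E" if "i \<in> I" for i
      using that q(1) pE(2) subspace_supported_on[of E]
      by (auto simp: I_def w_def intro!: subspace_diff subspace_scale)
    show "f i (w j) = (if i = j then 1 else 0)" if "i \<in> I" "j \<in> I" for i j
      using that pE q(2)
      by (auto simp: I_def f_def w_def divergence_diff divergence_scaleR sum_subtractf
          simp flip: sum_distrib_left)
  qed (use fin lin in auto)
  moreover have "card I = card V"
    using fin(2) r card_gt_0_iff[of V] by (auto simp: I_def card_image)
  moreover have "dim D = dim K"
  proof (rule span_eq_dim, rule subset_antisym)
    have K: "subspace K"
      using subspace_supported_on[of E] linear_add[OF lin] linear_scale[OF lin] linear_0[OF lin]
      unfolding K_def subspace_def by auto
    have "D \<subseteq> K"
      by (auto simp: D_def K_def I_def f_def unit_circulations_def circulations_def supported_on_def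
          divergence_diff sum_subtractf)
    then show "span D \<subseteq> span K" by (rule span_mono)
    have "x \<in> span D" if x: "x \<in> K" for x
    proof -
      have ne: "E \<noteq> {}" using pE(1) by auto
      define \<mu> where "\<mu> = Min (p ` E)"
      have \<mu>: "\<mu> > 0" "\<And>e. e \<in> E \<Longrightarrow> \<mu> \<le> p e" using fin ne p(2) by (auto simp: \<mu>_def)
      \<comment> \<open>\<open>S\<close> bounds every \<open>\<bar>x e\<bar>\<close>, so a step of
        size \<open>\<mu> / S\<close> moves no coordinate by more than the least weight of
        \<open>p\<close>. The summand 1 keeps \<open>S\<close> positive when \<open>x\<close> is
        0.\<close>
      define S where "S = 1 + (\<Sum>e\<in>E. \<bar>x e\<bar>)"
      have S: "S \<ge> 1" by (simp add: S_def sum_nonneg)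
      define \<epsilon> where "\<epsilon> = \<mu> / S"
      have \<epsilon>: "\<epsilon> > 0" using \<mu> S by (simp add: \<epsilon>_def)
      have xE: "x e = 0" if "e \<notin> E" for e using x that by (simp add: K_def supported_on_def)
      have "p e + \<epsilon> * x e \<ge> 0" if "e \<in> E" for e
      proof -
        have "\<bar>x e\<bar> \<le> S" unfolding S_def
          using member_le_sum[OF that, of "\<lambda>e. \<bar>x e\<bar>"] fin by simp
        then have "\<epsilon> * \<bar>x e\<bar> \<le> \<epsilon> * S" using \<epsilon> by simp
        also have "\<epsilon> * S = \<mu>" using S by (simp add: \<epsilon>_def)
        finally have "\<bar>\<epsilon> * x e\<bar> \<le> \<mu>" using \<epsilon> by (simp add: abs_mult)
        then show ?thesis using \<mu>(2)[OF that] by linarith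
      qed
      then have nn: "p e + \<epsilon> * x e \<ge> 0" for e
        using xE[of e] p(1) by (cases "e \<in> E") (auto simp: unit_circulations_def circulations_def)
      have div_V: "divergence E s t x u = 0" if "u \<in> V - {r}" for u
        using x that by (auto simp: K_def I_def f_def)
      then have "(\<Sum>u\<in>V. divergence E s t x u) = divergence E s t x r"
        using fin r by (simp add: sum.remove)
      then have div_r: "divergence E s t x r = 0" using sum_divergence[OF fin st] by simp
      have "divergence E s t x u = 0" if "u \<notin> V" for u
      proof -
        have none: "{e \<in> E. s e = u} = {}" "{e \<in> E. t e = u} = {}" using that st by auto
        show ?thesis unfolding divergence_def none by simp
      qed
      then have div: "divergence E s t x u = 0" for u using div_V div_r by blast
      have "sum x E = 0" using x by (auto simp: K_def I_def f_def)
      then have "sum (p + \<epsilon> *\<^sub>R x) E = 1"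
        using pE by (simp add: sum.distrib flip: sum_distrib_left)
      then have "p + \<epsilon> *\<^sub>R x \<in> ?P"
        using nn pE xE div
        by (simp add: unit_circulations_def circulations_def divergence_add divergence_scaleR supported_on_def)
      then have "(p + \<epsilon> *\<^sub>R x) - p \<in> D" unfolding D_def using p(1) by blast
      then have "(1 / \<epsilon>) *\<^sub>R ((p + \<epsilon> *\<^sub>R x) - p) \<in> span D" by (intro span_scale span_base)
      then show ?thesis using \<epsilon> by simp
    qed
    then show "span K \<subseteq> span D" by (intro span_minimal) auto
  qed
  ultimately show ?thesis
    by (simp add: affine_dim_def D_def[symmetric] dim_supported_on[OF fin(1)])
qed

subsection \<open>The overlap graph of 312-avoiding permutations\<close>

lemma Av_n_312_eq: "Av_n n {[3, 1, 2]} = av312 n"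
  by (simp only: Av_n_312 av312_def)

lemma ov_src_in_av312: "\<pi> \<in> av312 k \<Longrightarrow> ov_src k \<pi> \<in> av312 (k - 1)"
  unfolding ov_src_eq by (rule win_in_av312) auto

lemma ov_tgt_in_av312: "k \<ge> 1 \<Longrightarrow> \<pi> \<in> av312 k \<Longrightarrow> ov_tgt k \<pi> \<in> av312 (k - 1)"
  unfolding ov_tgt_eq by (rule win_in_av312) auto

abbreviation ov_circulations :: "nat \<Rightarrow> (nat list \<Rightarrow> real) set" where
  "ov_circulations k \<equiv> unit_circulations (av312 k) (ov_src k) (ov_tgt k)"

abbreviation ov_divergence :: "nat \<Rightarrow> (nat list \<Rightarrow> real) \<Rightarrow> nat list \<Rightarrow> real" where
  "ov_divergence k \<equiv> divergence (av312 k) (ov_src k) (ov_tgt k)"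

lemma simple_cycle_312_iff:
  "simple_cycle k {[3, 1, 2]} cs \<longleftrightarrow> graph_cycle (av312 k) (ov_src k) (ov_tgt k) cs"
proof -
  have nth: "rotate1 (map (ov_src k) cs) ! i = ov_src k (cs ! ((i + 1) mod length cs))"
    if "i < length cs" for i
  proof -
    have "(i + 1) mod length cs < length cs" using that by (intro mod_less_divisor) linarith
    then show ?thesis using that by (simp add: nth_rotate1)
  qed
  have "map (ov_tgt k) cs = rotate1 (map (ov_src k) cs) \<longleftrightarrow>
      (\<forall>i < length cs. map (ov_tgt k) cs ! i = rotate1 (map (ov_src k) cs) ! i)"
    by (subst list_eq_iff_nth_eq) simp
  also have "\<dots> \<longleftrightarrow> (\<forall>i < length cs. ov_tgt k (cs ! i) = ov_src k (cs ! ((i + 1) mod length cs)))"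
    by (intro all_cong1 imp_cong refl) (simp only: nth nth_map)
  finally have "map (ov_tgt k) cs = rotate1 (map (ov_src k) cs) \<longleftrightarrow>
      (\<forall>i < length cs. ov_tgt k (cs ! i) = ov_src k (cs ! ((i + 1) mod length cs)))" .
  moreover have "set (map (ov_src k) cs) \<subseteq> av312 (k - 1)" if "set cs \<subseteq> av312 k"
    using that ov_src_in_av312 by auto
  ultimately show ?thesis
    unfolding simple_cycle_def graph_cycle_def Av_n_312_eq by (auto simp: distinct_map)
qed

section \<open>Window counts as flows, and the feasible region\<close>

text \<open>Double counting: occurrences grouped by pattern are regrouped by start position, of
  which there are \<open>Suc n - k\<close>. Sources, targets and the constant map are the values of
  \<open>f\<close> used below.\<close>

lemma sum_c_occ_fibre:
  assumes \<sigma>: "\<sigma> \<in> av312 n"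
  shows "(\<Sum>\<pi>\<in>{\<pi> \<in> av312 k. f \<pi> = u}. real (c_occ \<pi> \<sigma>)) = (\<Sum>i<Suc n - k. of_bool (f (win k \<sigma> i) = u))"
proof -
  let ?S = "{i \<in> {..<Suc n - k}. f (win k \<sigma> i) = u}" and ?T = "{\<pi> \<in> av312 k. f \<pi> = u}"
  have "real (c_occ \<pi> \<sigma>) = (\<Sum>i\<in>{i \<in> ?S. win k \<sigma> i = \<pi>}. 1)" if \<pi>: "\<pi> \<in> ?T" for \<pi>
  proof -
    have "\<pi> \<in> perms k" using \<pi> by (simp add: av312_def)
    moreover have "{i. i + k \<le> length \<sigma> \<and> win k \<sigma> i = \<pi>} = {i \<in> ?S. win k \<sigma> i = \<pi>}"
      using \<pi> length_av312[OF \<sigma>] by auto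
    ultimately show ?thesis by (simp add: c_occ_eq)
  qed
  then have "(\<Sum>\<pi>\<in>?T. real (c_occ \<pi> \<sigma>)) = (\<Sum>\<pi>\<in>?T. \<Sum>i\<in>{i \<in> ?S. win k \<sigma> i = \<pi>}. 1)"
    by (intro sum.cong) auto
  also have "\<dots> = (\<Sum>i\<in>?S. 1)"
    by (intro sum.group) (auto simp: finite_av312 intro!: win_in_av312[OF \<sigma>])
  also have "\<dots> = (\<Sum>i<Suc n - k. of_bool (f (win k \<sigma> i) = u))"
    by (simp add: of_bool_def sum.If_cases Int_def)
  finally show ?thesis .
qed

text \<open>The edge read at \<open>i\<close> leads from the short window at \<open>i\<close> to
  that at \<open>i + 1\<close>, so only the two ends of the walk remain. For
  \<open>n = k - 1\<close> the walk has no edges and its ends coincide.\<close>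

lemma divergence_c_occ:
  assumes \<sigma>: "\<sigma> \<in> av312 n" and k: "k \<ge> 1" "k \<le> Suc n"
  shows "ov_divergence k (\<lambda>\<pi>. real (c_occ \<pi> \<sigma>)) u =
    of_bool (win (k - 1) \<sigma> 0 = u) - of_bool (win (k - 1) \<sigma> (Suc n - k) = u)"
proof -
  have "ov_src k (win k \<sigma> i) = win (k - 1) \<sigma> i" "ov_tgt k (win k \<sigma> i) = win (k - 1) \<sigma> (Suc i)" for i
    using k by (simp_all add: ov_src_eq ov_tgt_eq win_win)
  then show ?thesis
    unfolding divergence_def sum_c_occ_fibre[OF \<sigma>]
    using sum_lessThan_telescope'[of "\<lambda>i. of_bool (win (k - 1) \<sigma> i = u) :: real" "Suc n - k"]
    by (simp add: sum_subtractf)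
qed

lemma sum_c_occ:
  assumes "\<sigma> \<in> av312 n"
  shows "(\<Sum>\<pi>\<in>av312 k. real (c_occ \<pi> \<sigma>)) = real (Suc n - k)"
  using sum_c_occ_fibre[OF assms, where f = "\<lambda>_. ()" and u = "()"] by simp

lemma Av_312_iff: "\<sigma> \<in> Av {[3, 1, 2]} \<longleftrightarrow> \<sigma> \<in> av312 (length \<sigma>) \<and> \<sigma> \<noteq> []"
proof -
  have "\<sigma> \<in> Av {[3, 1, 2]} \<longleftrightarrow> (\<exists>n\<ge>1. \<sigma> \<in> av312 n)"
    unfolding Av_def Av_n_312_eq by auto
  also have "\<dots> \<longleftrightarrow> \<sigma> \<in> av312 (length \<sigma>) \<and> \<sigma> \<noteq> []"
    using length_av312 by (cases \<sigma>) fastforce+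
  finally show ?thesis .
qed

text \<open>Frequencies have divergence at most \<open>1 / n\<close> in absolute value, and both
  defining equations pass to the limit. Coordinates outside \<open>av312 k\<close> vanish because
  windows of avoiders avoid 312.\<close>

lemma feasible_region_subset_circulations:
  assumes "k \<ge> 1"
  shows "feasible_region k {[3, 1, 2]} \<subseteq> ov_circulations k"
proof
  let ?E = "av312 k"
  fix v assume "v \<in> feasible_region k {[3, 1, 2]}"
  then obtain s where v0: "\<And>\<pi>. \<pi> \<notin> perms k \<Longrightarrow> v \<pi> = 0"
    and vnn: "\<And>\<pi>. \<pi> \<in> perms k \<Longrightarrow> 0 \<le> v \<pi>"
    and s: "\<And>m. s m \<in> Av {[3, 1, 2]}" and len: "filterlim (\<lambda>m. length (s m)) at_top sequentially"
    and lim: "\<And>\<pi>. \<pi> \<in> perms k \<Longrightarrow> (\<lambda>m. c_occ_prop \<pi> (s m)) \<longlonglongrightarrow> v \<pi>"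
    unfolding feasible_region_def by blast
  define n where "n m = length (s m)" for m
  have sn: "s m \<in> av312 (n m)" "n m > 0" for m using s[of m] unfolding Av_312_iff by (auto simp: n_def)
  have n_top: "filterlim (\<lambda>m. real (n m)) at_top sequentially"
    unfolding n_def by (rule filterlim_compose[OF filterlim_real_sequentially len])
  have inv0: "(\<lambda>m. c / real (n m)) \<longlonglongrightarrow> 0" for c
    by (rule tendsto_divide_0[OF tendsto_const filterlim_at_top_imp_at_infinity[OF n_top]])
  have large: "\<forall>\<^sub>F m in sequentially. k \<le> n m"
    using len by (simp add: filterlim_at_top n_def)
  have limE: "(\<lambda>m. c_occ_prop \<pi> (s m)) \<longlonglongrightarrow> v \<pi>" if "\<pi> \<in> ?E" for \<pi>
    using lim that by (simp add: av312_def)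
  have out: "v \<pi> = 0" if "\<pi> \<notin> ?E" for \<pi>
  proof (cases "\<pi> \<in> perms k")
    case True
    have "c_occ \<pi> (s m) = 0" for m
    proof -
      have none: "{i. i + k \<le> length (s m) \<and> win k (s m) i = \<pi>} = {}"
        using that win_in_av312[OF sn(1)[of m]] by (auto simp: n_def)
      show ?thesis unfolding c_occ_eq[OF True] none by simp
    qed
    then have "(\<lambda>m. 0) \<longlonglongrightarrow> v \<pi>" using lim[OF True] by (simp add: c_occ_prop_def)
    then show ?thesis using LIMSEQ_unique tendsto_const by blast
  qed (use v0 in simp)
  have "ov_divergence k v u = 0" for u
  proof -
    have "(\<lambda>m. ov_divergence k (\<lambda>\<pi>. c_occ_prop \<pi> (s m)) u) \<longlonglongrightarrow> ov_divergence k v u"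
      unfolding divergence_def by (intro tendsto_diff tendsto_sum limE) auto
    moreover have "(\<lambda>m. ov_divergence k (\<lambda>\<pi>. c_occ_prop \<pi> (s m)) u) \<longlonglongrightarrow> 0"
    proof (rule tendsto_rabs_zero_cancel, rule tendsto_sandwich[OF _ _ tendsto_const inv0[of 1]])
      show "\<forall>\<^sub>F m in sequentially. \<bar>ov_divergence k (\<lambda>\<pi>. c_occ_prop \<pi> (s m)) u\<bar> \<le> 1 / real (n m)"
        using large
      proof eventually_elim
        case (elim m)
        have "(\<lambda>\<pi>. c_occ_prop \<pi> (s m)) = (1 / real (n m)) *\<^sub>R (\<lambda>\<pi>. real (c_occ \<pi> (s m)))"
          by (simp add: fun_eq_iff c_occ_prop_def n_def)
        then have "ov_divergence k (\<lambda>\<pi>. c_occ_prop \<pi> (s m)) u =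
            (1 / real (n m)) * ov_divergence k (\<lambda>\<pi>. real (c_occ \<pi> (s m))) u"
          by (simp only: divergence_scaleR)
        moreover have "\<bar>ov_divergence k (\<lambda>\<pi>. real (c_occ \<pi> (s m))) u\<bar> \<le> 1"
          using divergence_c_occ[OF sn(1) assms, of m u] elim by simp
        ultimately show ?case by (simp add: abs_mult divide_right_mono)
      qed
    qed simp
    ultimately show ?thesis using LIMSEQ_unique by blast
  qed
  moreover have "sum v ?E = 1"
  proof -
    have "(\<lambda>m. \<Sum>\<pi>\<in>?E. c_occ_prop \<pi> (s m)) \<longlonglongrightarrow> sum v ?E"
      by (intro tendsto_sum limE)
    moreover have "(\<lambda>m. \<Sum>\<pi>\<in>?E. c_occ_prop \<pi> (s m)) \<longlonglongrightarrow> 1"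
    proof (rule Lim_transform_eventually)
      \<comment> \<open>There are \<open>n - k + 1\<close> windows, normalised by
        \<open>n\<close>.\<close>
      show "(\<lambda>m. 1 - (real k - 1) / real (n m)) \<longlonglongrightarrow> 1"
        using tendsto_diff[OF tendsto_const inv0[of "real k - 1"], of 1] by simp
      show "\<forall>\<^sub>F m in sequentially. 1 - (real k - 1) / real (n m) = (\<Sum>\<pi>\<in>?E. c_occ_prop \<pi> (s m))"
        using large
      proof eventually_elim
        case (elim m)
        have "(\<Sum>\<pi>\<in>?E. c_occ_prop \<pi> (s m)) = (\<Sum>\<pi>\<in>?E. real (c_occ \<pi> (s m))) / real (n m)"
          by (simp add: c_occ_prop_def n_def sum_divide_distrib)
        then show ?case using elim sn(2)[of m] by (simp add: sum_c_occ[OF sn(1)] of_nat_diff field_simps)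
      qed
    qed
    ultimately show ?thesis using LIMSEQ_unique by blast
  qed
  moreover have "0 \<le> v \<pi>" for \<pi> using vnn v0 by (cases "\<pi> \<in> perms k") auto
  ultimately show "v \<in> ov_circulations k"
    using out by (simp add: unit_circulations_def circulations_def)
qed

text \<open>The error bound is uniform in \<open>t\<close>, so that direct sums make this a convex condition.\<close>
definition approximable :: "nat \<Rightarrow> (nat list \<Rightarrow> real) set" where
  "approximable k = {v. \<exists>C. \<forall>t\<ge>0. \<exists>n. \<exists>\<sigma>\<in>av312 n. \<bar>real n - t\<bar> \<le> C \<and>
     (\<forall>\<pi>\<in>perms k. \<bar>real (c_occ \<pi> \<sigma>) - t * v \<pi>\<bar> \<le> C)}"

text \<open>Sum an approximant of size about \<open>t * a\<close> with one of size about
  \<open>t * b\<close>; the extra \<open>k\<close> in the error pays for the seam.\<close>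

lemma convex_approximable:
  assumes "k \<ge> 1"
  shows "convex (approximable k)"
proof (rule convexI)
  fix v w and a b :: real
  assume v: "v \<in> approximable k" and w: "w \<in> approximable k" and ab: "0 \<le> a" "0 \<le> b" "a + b = 1"
  obtain C where C: "\<And>t. t \<ge> 0 \<Longrightarrow> \<exists>n. \<exists>\<sigma>\<in>av312 n. \<bar>real n - t\<bar> \<le> C \<and>
     (\<forall>\<pi>\<in>perms k. \<bar>real (c_occ \<pi> \<sigma>) - t * v \<pi>\<bar> \<le> C)"
    using v unfolding approximable_def by blast
  obtain D where D: "\<And>t. t \<ge> 0 \<Longrightarrow> \<exists>n. \<exists>\<sigma>\<in>av312 n. \<bar>real n - t\<bar> \<le> D \<and>
     (\<forall>\<pi>\<in>perms k. \<bar>real (c_occ \<pi> \<sigma>) - t * w \<pi>\<bar> \<le> D)"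
    using w unfolding approximable_def by blast
  have "\<exists>n. \<exists>\<sigma>\<in>av312 n. \<bar>real n - t\<bar> \<le> C + D + k \<and>
     (\<forall>\<pi>\<in>perms k. \<bar>real (c_occ \<pi> \<sigma>) - t * (a *\<^sub>R v + b *\<^sub>R w) \<pi>\<bar> \<le> C + D + k)"
    if t: "t \<ge> 0" for t
  proof -
    obtain n \<sigma> where \<sigma>: "\<sigma> \<in> av312 n" "\<bar>real n - t * a\<bar> \<le> C"
      "\<forall>\<pi>\<in>perms k. \<bar>real (c_occ \<pi> \<sigma>) - t * a * v \<pi>\<bar> \<le> C"
      using C[of "t * a"] ab t by auto
    obtain m \<tau> where \<tau>: "\<tau> \<in> av312 m" "\<bar>real m - t * b\<bar> \<le> D"
      "\<forall>\<pi>\<in>perms k. \<bar>real (c_occ \<pi> \<tau>) - t * b * w \<pi>\<bar> \<le> D"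
      using D[of "t * b"] ab t by auto
    have "t = t * a + t * b" using ab by (simp flip: distrib_left)
    then have "\<bar>real (n + m) - t\<bar> \<le> C + D + k" using \<sigma>(2) \<tau>(2) by simp
    moreover have "\<bar>real (c_occ \<pi> (osum \<sigma> \<tau>)) - t * (a *\<^sub>R v + b *\<^sub>R w) \<pi>\<bar> \<le> C + D + k"
      if \<pi>: "\<pi> \<in> perms k" for \<pi>
    proof -
      have "t * (a *\<^sub>R v + b *\<^sub>R w) \<pi> = t * a * v \<pi> + t * b * w \<pi>"
        by (simp add: algebra_simps)
      then show ?thesis
        using c_occ_osum[OF \<pi> assms, of \<sigma> \<tau>] \<sigma>(3)[rule_format, OF \<pi>] \<tau>(3)[rule_format, OF \<pi>]
        by linarith
    qed
    ultimately show ?thesis using osum_in_av312[OF \<sigma>(1) \<tau>(1)] by blast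
  qed
  then show "a *\<^sub>R v + b *\<^sub>R w \<in> approximable k" unfolding approximable_def by blast
qed

text \<open>The admissible quotients number \<open>M div L\<close> or one more. It counts the visits
  of a periodic walk to one of its edges.\<close>

lemma card_residue_class:
  assumes "j < L"
  shows "\<bar>real (card {i. i < M \<and> i mod L = j}) - real M / real L\<bar> \<le> 1"
proof -
  have "{i. i < M \<and> i mod L = j} = (\<lambda>q. q * L + j) ` {q. q * L + j < M}"
  proof (intro set_eqI iffI)
    fix i assume "i \<in> {i. i < M \<and> i mod L = j}"
    then show "i \<in> (\<lambda>q. q * L + j) ` {q. q * L + j < M}"
      using div_mult_mod_eq[of i L] by (intro image_eqI[of _ _ "i div L"]) auto
  qed (use assms in auto)
  moreover have "inj_on (\<lambda>q. q * L + j) {q. q * L + j < M}" using assms by (auto simp: inj_on_def)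
  ultimately have c: "card {i. i < M \<and> i mod L = j} = card {q. q * L + j < M}"
    by (simp add: card_image)
  have lo: "{..<M div L} \<subseteq> {q. q * L + j < M}"
  proof
    fix q assume "q \<in> {..<M div L}"
    then have "(q + 1) * L \<le> M div L * L" by (intro mult_right_mono) auto
    also have "\<dots> \<le> M" by simp
    finally show "q \<in> {q. q * L + j < M}" using assms by simp
  qed
  have hi: "{q. q * L + j < M} \<subseteq> {..M div L}"
  proof
    fix q assume "q \<in> {q. q * L + j < M}"
    then have "q * L \<le> M" by simp
    then show "q \<in> {..M div L}" using assms by (simp add: less_eq_div_iff_mult_less_eq)
  qed
  have "M div L \<le> card {q. q * L + j < M}"
    using card_mono[OF finite_subset[OF hi finite_atMost] lo] by simp
  moreover have "card {q. q * L + j < M} \<le> Suc (M div L)"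
    using card_mono[OF finite_atMost hi] by simp
  moreover have "real (M div L) \<le> real M / real L" "real M / real L \<le> real (M div L) + 1"
    using of_nat_of_nat_div_aux[of M L, where 'a = real] assms
    by (simp_all add: divide_le_eq less_imp_le)
  ultimately show ?thesis unfolding c by linarith
qed

lemma cycle_vec_approximable:
  assumes "k \<ge> 1" and cs: "graph_cycle (av312 k) (ov_src k) (ov_tgt k) cs"
  shows "cycle_vec cs \<in> approximable k"
proof -
  obtain h where h: "k = Suc h" using assms(1) by (cases k) auto
  define L where "L = length cs"
  have L: "L > 0" and sub: "set cs \<subseteq> av312 k" and rot: "map (ov_tgt k) cs = rotate1 (map (ov_src k) cs)"
    using cs by (auto simp: graph_cycle_def L_def)
  note d = graph_cycle_distinct[OF cs]
  define e where "e i = cs ! (i mod L)" for i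
  have e: "e i \<in> av312 (Suc h)" for i using sub L by (auto simp: e_def h L_def)
  have step: "win h (e i) 1 = win h (e (Suc i)) 0" for i
  proof -
    have "ov_tgt k (e i) = map (ov_tgt k) cs ! (i mod L)" using L by (simp add: e_def L_def)
    also have "\<dots> = ov_src k (cs ! (Suc (i mod L) mod L))"
      unfolding rot using L by (subst nth_rotate1) (auto simp: L_def)
    finally show ?thesis by (simp add: ov_tgt_eq ov_src_eq h e_def mod_Suc_eq)
  qed
  \<comment> \<open>The periodic walk is cut after \<open>Suc N\<close> edges, with \<open>N\<close>
    the floor of \<open>t\<close>. Occurrence counts are off by at most 2, one from the residue
    class and one from replacing \<open>Suc N\<close> by \<open>t\<close>; the length is off by at
    most \<open>k\<close>.\<close>
  have "\<exists>n. \<exists>\<sigma>\<in>av312 n. \<bar>real n - t\<bar> \<le> k + 2 \<and>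
      (\<forall>\<pi>\<in>perms k. \<bar>real (c_occ \<pi> \<sigma>) - t * cycle_vec cs \<pi>\<bar> \<le> k + 2)" if t: "t \<ge> 0" for t :: real
  proof -
    define N where "N = nat \<lfloor>t\<rfloor>"
    have N: "real N \<le> t" "t < real N + 1" using t unfolding N_def by linarith+
    obtain \<sigma> where \<sigma>: "\<sigma> \<in> av312 (N + Suc h)" "\<forall>i\<le>N. win (Suc h) \<sigma> i = e i"
      using av312_realise_walk[of e, OF e step] by blast
    have "\<bar>real (c_occ \<pi> \<sigma>) - t * cycle_vec cs \<pi>\<bar> \<le> k + 2" if \<pi>: "\<pi> \<in> perms k" for \<pi>
    proof -
      have c: "c_occ \<pi> \<sigma> = card {i. i < Suc N \<and> e i = \<pi>}"
      proof -
        have "{i. i + k \<le> length \<sigma> \<and> win k \<sigma> i = \<pi>} = {i. i < Suc N \<and> e i = \<pi>}"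
          using \<sigma> length_av312[OF \<sigma>(1)] by (auto simp: h)
        then show ?thesis using c_occ_eq[OF \<pi>] by simp
      qed
      show ?thesis
      proof (cases "\<pi> \<in> set cs")
        case True
        then obtain j where j: "j < L" "cs ! j = \<pi>" by (auto simp: in_set_conv_nth L_def)
        have "e i = \<pi> \<longleftrightarrow> i mod L = j" for i
          using j L nth_eq_iff_index_eq[OF d, of "i mod L" j] by (auto simp: e_def L_def)
        then have "\<bar>real (c_occ \<pi> \<sigma>) - real (Suc N) / L\<bar> \<le> 1"
          using card_residue_class[OF j(1), of "Suc N"] by (simp add: c)
        moreover have "\<bar>real (Suc N) / L - t / L\<bar> \<le> 1"
        proof -
          have "\<bar>real (Suc N) / L - t / L\<bar> = \<bar>real (Suc N) - t\<bar> / L"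
            by (simp add: diff_divide_distrib[symmetric])
          also have "\<dots> \<le> 1" using N L by (simp add: divide_le_eq)
          finally show ?thesis .
        qed
        moreover have "t * cycle_vec cs \<pi> = t / L" using True by (simp add: cycle_vec_distinct[OF d] L_def)
        ultimately show ?thesis by linarith
      next
        case False
        then have "e i \<noteq> \<pi>" for i using L by (auto simp: e_def L_def)
        then show ?thesis using False by (simp add: c cycle_vec_distinct[OF d])
      qed
    qed
    moreover have "\<bar>real (N + Suc h) - t\<bar> \<le> k + 2" using N by (simp add: h)
    ultimately show ?thesis using \<sigma>(1) by blast
  qed
  then show ?thesis unfolding approximable_def by blast
qed

lemma circulations_subset_feasible_region:
  assumes "k \<ge> 1"
  shows "ov_circulations k \<subseteq> feasible_region k {[3, 1, 2]}"
proof
  let ?E = "av312 k"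
  fix v assume v: "v \<in> ov_circulations k"
  have "ov_circulations k \<subseteq> approximable k"
    unfolding unit_circulations_eq_convex_hull[OF finite_av312]
    using cycle_vec_approximable[OF assms] by (intro hull_minimal convex_approximable[OF assms]) auto
  then obtain C where C: "\<And>t. t \<ge> 0 \<Longrightarrow> \<exists>n. \<exists>\<sigma>\<in>av312 n. \<bar>real n - t\<bar> \<le> C \<and>
     (\<forall>\<pi>\<in>perms k. \<bar>real (c_occ \<pi> \<sigma>) - t * v \<pi>\<bar> \<le> C)"
    using v unfolding approximable_def by blast
  have C0: "C \<ge> 0" using C[of 0] by force
  \<comment> \<open>The shift by \<open>C + 1\<close> outweighs the error in the length, so
    \<open>s m\<close> has length at least \<open>Suc m\<close>.\<close>
  define T where "T m = real m + C + 1" for m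
  have T: "T m \<ge> 0" for m using C0 by (simp add: T_def)
  have "\<exists>\<sigma>. \<sigma> \<in> av312 (length \<sigma>) \<and> \<bar>real (length \<sigma>) - T m\<bar> \<le> C \<and>
     (\<forall>\<pi>\<in>perms k. \<bar>real (c_occ \<pi> \<sigma>) - T m * v \<pi>\<bar> \<le> C)" for m
    using C[OF T[of m]] length_av312 by metis
  then obtain s where s: "\<And>m. s m \<in> av312 (length (s m))"
    and sT: "\<And>m. \<bar>real (length (s m)) - T m\<bar> \<le> C"
    and occ: "\<And>m \<pi>. \<pi> \<in> perms k \<Longrightarrow> \<bar>real (c_occ \<pi> (s m)) - T m * v \<pi>\<bar> \<le> C"
    by metis
  have ge: "length (s m) \<ge> Suc m" for m using sT[of m] unfolding T_def by linarith
  have nn: "0 \<le> v \<pi>" for \<pi> using v by (simp add: unit_circulations_def circulations_def)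
  have le1: "v \<pi> \<le> 1" for \<pi>
  proof (cases "\<pi> \<in> ?E")
    case True
    then have "v \<pi> \<le> sum v ?E" using nn finite_av312 by (intro member_le_sum) auto
    then show ?thesis using v by (simp add: unit_circulations_def)
  qed (use v in \<open>simp add: unit_circulations_def circulations_def\<close>)
  have "(\<lambda>m. c_occ_prop \<pi> (s m)) \<longlonglongrightarrow> v \<pi>" if \<pi>: "\<pi> \<in> perms k" for \<pi>
  proof (rule LIM_zero_cancel, rule tendsto_rabs_zero_cancel, rule tendsto_sandwich[OF _ _ tendsto_const])
    show "(\<lambda>m. 2 * C / real (Suc m)) \<longlonglongrightarrow> 0"
      by (rule tendsto_divide_0[OF tendsto_const])
        (intro filterlim_at_top_imp_at_infinity filterlim_compose[OF filterlim_real_sequentially filterlim_Suc])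
    \<comment> \<open>One \<open>C\<close> comes from the occurrence count, the other from replacing
      \<open>T m\<close> by the actual length, using \<open>v \<pi> \<le> 1\<close>.\<close>
    have "\<bar>c_occ_prop \<pi> (s m) - v \<pi>\<bar> \<le> 2 * C / real (Suc m)" for m
    proof -
      let ?n = "real (length (s m))"
      have n: "?n > 0" using ge[of m] by linarith
      have "\<bar>T m * v \<pi> - ?n * v \<pi>\<bar> = \<bar>?n - T m\<bar> * v \<pi>"
        using nn[of \<pi>] by (simp add: abs_mult abs_minus_commute flip: left_diff_distrib)
      also have "\<dots> \<le> C * 1" using sT[of m] nn le1 C0 by (intro mult_mono) auto
      finally have "\<bar>real (c_occ \<pi> (s m)) - ?n * v \<pi>\<bar> \<le> 2 * C" using occ[OF \<pi>, of m] by linarith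
      moreover have "c_occ_prop \<pi> (s m) - v \<pi> = (real (c_occ \<pi> (s m)) - ?n * v \<pi>) / ?n"
        using n by (simp add: c_occ_prop_def field_simps)
      ultimately have "\<bar>c_occ_prop \<pi> (s m) - v \<pi>\<bar> \<le> 2 * C / ?n"
        using n by (simp add: divide_right_mono)
      also have "\<dots> \<le> 2 * C / real (Suc m)" using ge[of m] C0 n by (intro divide_left_mono mult_pos_pos) auto
      finally show ?thesis .
    qed
    then show "\<forall>\<^sub>F m in sequentially. \<bar>c_occ_prop \<pi> (s m) - v \<pi>\<bar> \<le> 2 * C / real (Suc m)" by simp
  qed simp
  moreover have "s m \<in> Av {[3, 1, 2]}" for m
  proof -
    have "length (s m) \<noteq> 0" using ge[of m] by linarith
    then show ?thesis using s[of m] unfolding Av_312_iff by simp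
  qed
  moreover have "filterlim (\<lambda>m. length (s m)) at_top sequentially"
    by (rule filterlim_at_top_mono[OF filterlim_Suc]) (use ge in simp)
  moreover have "v \<pi> = 0" if "\<pi> \<notin> perms k" for \<pi>
    using v that by (auto simp: unit_circulations_def circulations_def av312_def)
  ultimately show "v \<in> feasible_region k {[3, 1, 2]}"
    unfolding feasible_region_def using nn le1 by blast
qed

section \<open>Test flows for the dimension\<close>

lemma upt_in_av312: "[1..<Suc n] \<in> av312 n"
proof -
  have "\<not> has312 [1..<Suc n]"
    unfolding has312_def by (auto simp del: upt_Suc)
  then show ?thesis by (auto simp: av312_def perms_def)
qed

text \<open>\<open>c_occ\<close> also counts patterns of other sizes; cutting it off places the
  count vector in \<open>supported_on (av312 k)\<close>.\<close>

definition occ_vec :: "nat \<Rightarrow> nat list \<Rightarrow> nat list \<Rightarrow> real" where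
  "occ_vec k \<sigma> \<pi> = (if \<pi> \<in> av312 k then real (c_occ \<pi> \<sigma>) else 0)"

text \<open>The windows of \<open>osum \<sigma> r\<close> trace a walk from the first short window
  of \<sigma> to \<open>r\<close>.\<close>

lemma divergence_occ_vec_osum:
  assumes "k \<ge> 1" and \<sigma>: "\<sigma> \<in> av312 n" "k - 1 \<le> n" and r: "r \<in> av312 (k - 1)"
  shows "ov_divergence k (occ_vec k (osum \<sigma> r)) x = of_bool (x = win (k - 1) \<sigma> 0) - of_bool (x = r)"
proof -
  have "ov_divergence k (occ_vec k (osum \<sigma> r)) x = ov_divergence k (\<lambda>\<pi>. real (c_occ \<pi> (osum \<sigma> r))) x"
    by (rule divergence_cong) (simp add: occ_vec_def)
  also have "\<dots> = of_bool (win (k - 1) (osum \<sigma> r) 0 = x) -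
      of_bool (win (k - 1) (osum \<sigma> r) (Suc (n + (k - 1)) - k) = x)"
    using assms by (intro divergence_c_occ osum_in_av312) auto
  also have "win (k - 1) (osum \<sigma> r) (Suc (n + (k - 1)) - k) = r"
    using assms(1) win_osum2[of "k - 1" \<sigma> r 0] win_perms[of r "k - 1"] r length_av312[OF \<sigma>(1)]
    by (simp add: av312_def)
  also have "win (k - 1) (osum \<sigma> r) 0 = win (k - 1) \<sigma> 0"
    using \<sigma> by (simp add: win_osum1 length_av312)
  finally show ?thesis by (simp add: eq_commute)
qed

text \<open>The walk read off \<open>osum \<pi> (ov_src k \<pi>)\<close> begins with the edge \<pi>
  and returns to its source. Adding these circulations over all \<pi> reaches every edge; dividing
  by the mass normalises.\<close>

lemma positive_ov_circulation:
  assumes "k \<ge> 1"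
  obtains p where "p \<in> ov_circulations k" "\<And>\<pi>. \<pi> \<in> av312 k \<Longrightarrow> p \<pi> > 0"
proof -
  let ?E = "av312 k"
  define c where "c \<pi> = occ_vec k (osum \<pi> (ov_src k \<pi>))" for \<pi>
  have div: "ov_divergence k (c \<pi>) u = 0" if "\<pi> \<in> ?E" for \<pi> u
    unfolding c_def using divergence_occ_vec_osum[OF assms that _ ov_src_in_av312[OF that]]
    by (simp add: ov_src_eq)
  have pos: "c \<pi> \<pi> > 0" if "\<pi> \<in> ?E" for \<pi>
  proof -
    have \<pi>: "\<pi> \<in> perms k" using that by (simp add: av312_def)
    let ?S = "{i. i + k \<le> length (osum \<pi> (ov_src k \<pi>)) \<and> win k (osum \<pi> (ov_src k \<pi>)) i = \<pi>}"
    have "0 \<in> ?S" using win_perms[OF \<pi>] length_perms[OF \<pi>] by (simp add: win_osum1)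
    moreover have "finite ?S" by (rule finite_subset[of _ "{..length (osum \<pi> (ov_src k \<pi>))}"]) auto
    ultimately have "card ?S > 0" using card_gt_0_iff by blast
    then show ?thesis using that by (simp add: c_def occ_vec_def c_occ_eq[OF \<pi>])
  qed
  have nn: "c \<pi> \<rho> \<ge> 0" for \<pi> \<rho> by (simp add: c_def occ_vec_def)
  define q where "q = (\<lambda>\<rho>. \<Sum>\<pi>\<in>?E. c \<pi> \<rho>)"
  have qpos: "q \<rho> > 0" if "\<rho> \<in> ?E" for \<rho>
    unfolding q_def using that pos nn finite_av312 by (intro sum_pos2[of _ \<rho>]) auto
  have "?E \<noteq> {}" using upt_in_av312 by blast
  then have S: "sum q ?E > 0" using qpos finite_av312 by (intro sum_pos) auto
  have "ov_divergence k q u = 0" for u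
    unfolding q_def by (simp add: divergence_sum[OF finite_av312] div)
  moreover have "q \<rho> \<ge> 0" for \<rho> by (simp add: q_def sum_nonneg nn)
  moreover have "q \<rho> = 0" if "\<rho> \<notin> ?E" for \<rho> using that by (simp add: q_def c_def occ_vec_def)
  ultimately have "(1 / sum q ?E) *\<^sub>R q \<in> ov_circulations k"
    using S by (simp add: unit_circulations_def circulations_def divergence_scaleR sum_divide_distrib[symmetric])
  then show thesis using that[of "(1 / sum q ?E) *\<^sub>R q"] qpos S by simp
qed

lemma affine_dim_ov_circulations:
  assumes "k \<ge> 1"
  shows "affine_dim (ov_circulations k) + card (av312 (k - 1)) = card (av312 k)"
proof -
  obtain p where p: "p \<in> ov_circulations k" "\<And>\<pi>. \<pi> \<in> av312 k \<Longrightarrow> p \<pi> > 0"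
    using positive_ov_circulation[OF assms] by blast
  define r where "r = [1..<Suc (k - 1)]"
  have r: "r \<in> av312 (k - 1)" unfolding r_def by (rule upt_in_av312)
  show ?thesis
  proof (rule affine_dim_unit_circulations[OF finite_av312 finite_av312 _ _ r p,
        where q = "\<lambda>u. occ_vec k (osum u r)"])
    show "ov_src k ` av312 k \<subseteq> av312 (k - 1)" using ov_src_in_av312 by blast
    show "ov_tgt k ` av312 k \<subseteq> av312 (k - 1)" using ov_tgt_in_av312[OF assms] by blast
    show "occ_vec k (osum u r) \<in> supported_on (av312 k)" for u
      by (simp add: supported_on_def occ_vec_def)
    show "ov_divergence k (occ_vec k (osum u r)) x = of_bool (x = u) - of_bool (x = r)"
      if "u \<in> av312 (k - 1) - {r}" for u x
    proof -
      have "u \<in> av312 (k - 1)" using that by simp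
      moreover have "win (k - 1) u 0 = u" using that win_perms by (simp add: av312_def)
      ultimately show ?thesis using divergence_occ_vec_osum[OF assms _ _ r] by simp
    qed
  qed
qed

theorem mainTheorem3:
  fixes k :: nat
  assumes "k \<ge> 1"
  shows "feasible_region k {[3,1,2]} = cycle_polytope k {[3,1,2]}
    \<and> int (affine_dim (feasible_region k {[3,1,2]})) = int (catalan k) - int (catalan (k - 1))
    \<and> {x. x extreme_point_of feasible_region k {[3,1,2]}}
        = {cycle_vec cs | cs. simple_cycle k {[3,1,2]} cs}"
proof -
  have eq: "feasible_region k {[3,1,2]} = ov_circulations k"
    using feasible_region_subset_circulations[OF assms] circulations_subset_feasible_region[OF assms]
    by (rule subset_antisym)
  have hull: "ov_circulations k = convex hull {cycle_vec cs |cs. simple_cycle k {[3,1,2]} cs}"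
    unfolding simple_cycle_312_iff by (rule unit_circulations_eq_convex_hull[OF finite_av312])
  have "int (affine_dim (ov_circulations k)) = int (catalan k) - int (catalan (k - 1))"
    using affine_dim_ov_circulations[OF assms] by (simp add: card_av312)
  moreover have "{x. x extreme_point_of ov_circulations k} = {cycle_vec cs |cs. simple_cycle k {[3,1,2]} cs}"
  proof
    \<comment> \<open>Extreme points of a convex hull belong to the generating set; the other
      inclusion needs the uniqueness argument.\<close>
    show "{x. x extreme_point_of ov_circulations k} \<subseteq> {cycle_vec cs |cs. simple_cycle k {[3,1,2]} cs}"
      unfolding hull using extreme_point_of_convex_hull by blast
    show "{cycle_vec cs |cs. simple_cycle k {[3,1,2]} cs} \<subseteq> {x. x extreme_point_of ov_circulations k}"
      unfolding simple_cycle_312_iff using cycle_vec_extreme_point[OF finite_av312] by blast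
  qed
  ultimately show ?thesis using hull unfolding eq cycle_polytope_def by blast
qed

end
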